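(* Let $X=(X_t)_{t\in\mathbb R}$ be an RSMPR process with independent regression property (defined in the context), with $EX_0=0$, time scaled so that $\alpha_1=1$, and with moment generating function $E e^{yX_0}=\exp\left(\sum_{j\ge2}\delta_jy^j/j!\right)$. Define $Y_\tau=\sqrt{\tau}\,X_{(\ln\tau)/(2\alpha_1)}$ for $\tau>0$. Then: i) $Y$ has independent increments and is a harness; ii) $Y$ is not a Lévy process unless $X$ is an Ornstein–Uhlenbeck process, i.e. unless the polynomials $\{h_n\}$ orthonormal with respect to the stationary law are (suitably scaled) Hermite polynomials. More precisely, for $\tau>\sigma>0$, $$E\exp(yY_\tau)=\exp\Big(\sum_{j\ge2}\delta_j\tau^{j/2}y^j/j!\Big),$$ $$E\exp(y(Y_\tau-Y_\sigma))=\exp\Big(\sum_{j\ge2}\delta_j(\tau^{j/2}-\sigma^{j/2})y^j/j!\Big).$$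
   Context: Let $X=(X_t)_{t\in\mathbb R}$ be a real Markov process, $\mathcal F_{\le s}=\sigma(X_r:r\le s)$; $\mu$ is the law of $X_0$, $v\in\mathbb N\cup\{\infty\}$ is the number of points in $\operatorname{supp}\mu$. Equalities between random variables are almost sure. $X$ is an SMPR process (stationary Markov process with polynomial regression) if: (a) it is stationary: $X_t\sim\mu$ for all $t$, and the conditional law of $X_{t}$ given $X_s=y$, $s<t$, depends only on $y$ and $t-s$; (b) all moments of $X_0$ are finite and $\mu$ is identifiable by its moments; (c) (totally linearly dependent, TLD) for all $0<n\le v-1$ and all distinct $s_1,\dots,s_n$ the matrix $[\operatorname{cov}(X_{s_i},X_{s_j})]$ is non-singular; (d) (mean-square continuous, MSC) for all $m,j\ge 0$ the quantity $E X_t^mX_s^j$ is a function of $|t-s|$, continuous at least at $0$; (e) for all $1\le n<v$ and $s<t$, $E(X_t^n|\mathcal F_{\le s})=Q_n(X_s,t-s)$ where $Q_n(x,\tau)=\sum_{j=0}^n\gamma_{n,j}(\tau)x^j$ is a polynomial in $x$ of degree exactly $n$; (f) for each $n<v$ the lower triangular $(n+1)\times(n+1)$ matrices $A_n(t)$ with entries $\gamma_{i,j}(t)$, $0\le j\le i\le n$, $\gamma_{0,0}=1$, are diagonalizable. Then $A_n(t)=V_n\Lambda_n(t)V_n^{-1}$ with $V_n$ lower triangular not depending on $t$ and $\Lambda_n(t)=\mathrm{diag}\{1,e^{-\alpha_1t},\dots,e^{-\alpha_nt}\}$. Consequently there are real numbers $\alpha_n$ ($\alpha_0=0$), called correlation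 indices, and monic polynomials $p_n$ with $\deg p_n=n$, $0\le n<v$, with $E(p_n(X_t)|\mathcal F_{\le s})=e^{-\alpha_n(t-s)}p_n(X_s)$ for $s<t$. The process is called regular (RSMPR) if the polynomials $p_n$ are orthogonal with respect to $\mu$; then $h_n=p_n/\sqrt{Ep_n^2(X_0)}$. An RSMPR process has the independent regression property if for all $s<t$ and $j\ge1$ the conditional moment $E((X_t-E(X_t|\mathcal F_{\le s}))^j|\mathcal F_{\le s})$ is non-random (does not depend on $X_s$). A process $Y$ is a harness if for all $s<t<u$, $E(Y_t|\sigma(Y_r:r\notin(s,u)))$ is a polynomial of degree $1$ in $Y_s$ and $Y_u$. $Y$ being a Lévy process means that (with $Y_0=0$) it has independent increments and $Y_\tau-Y_\sigma\sim Y_{\tau-\sigma}$ for $\tau\ge\sigma$. An Ornstein–Uhlenbeck process is a stationary centered Gaussian process with $\operatorname{cov}(X_t,X_s)=\sigma^2\exp(-\alpha|t-s|)$, $\alpha>0$. *)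

theory Defs
  imports
    "HOL-Probability.Probability"
    "HOL-Library.Extended_Nat"
    "HOL-Computational_Algebra.Polynomial"
    "Jordan_Normal_Form.Matrix"
begin

definition gen_sigma :: "'a measure \<Rightarrow> ('i \<Rightarrow> 'a \<Rightarrow> real) \<Rightarrow> 'i set \<Rightarrow> 'a measure" where
  "gen_sigma M X I = sigma (space M) {X i -` B \<inter> space M | i B. i \<in> I \<and> B \<in> sets borel}"

definition measure_support :: "'b::topological_space measure \<Rightarrow> 'b set" where
  "measure_support \<mu> = {x. \<forall>U. open U \<longrightarrow> x \<in> U \<longrightarrow> emeasure \<mu> U > 0}"

definition ecard :: "'b set \<Rightarrow> enat" where
  "ecard S = (if finite S then enat (card S) else \<infinity>)"

definition covariance :: "'a measure \<Rightarrow> ('a \<Rightarrow> real) \<Rightarrow> ('a \<Rightarrow> real) \<Rightarrow> real" where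
  "covariance M U V = (\<integral>\<omega>. (U \<omega> - (\<integral>\<omega>'. U \<omega>' \<partial>M)) * (V \<omega> - (\<integral>\<omega>'. V \<omega>' \<partial>M)) \<partial>M)"


section \<open>Stationary Markov processes with polynomial regression\<close>

definition markov_process :: "'a measure \<Rightarrow> (real \<Rightarrow> 'a \<Rightarrow> real) \<Rightarrow> bool" where
  "markov_process M X \<longleftrightarrow>
     (\<forall>t. X t \<in> borel_measurable M) \<and>
     (\<forall>s t B. s < t \<longrightarrow> B \<in> sets borel \<longrightarrow>
        (AE \<omega> in M. real_cond_exp M (gen_sigma M X {..s}) (indicator (X t -` B \<inter> space M)) \<omega> =
                    real_cond_exp M (gen_sigma M X {s}) (indicator (X t -` B \<inter> space M)) \<omega>))"

text \<open>
  \<open>K \<tau> y\<close> is the conditional law of \<open>X\<^sub>t\<close> given \<open>X\<^sub>s = y\<close> for \<open>t - s = \<tau>\<close>.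
  For a Markov process this is strict stationarity.
\<close>

definition stationary :: "'a measure \<Rightarrow> (real \<Rightarrow> 'a \<Rightarrow> real) \<Rightarrow> bool" where
  "stationary M X \<longleftrightarrow>
     (\<forall>t. distr M borel (X t) = distr M borel (X 0)) \<and>
     (\<exists>K :: real \<Rightarrow> real \<Rightarrow> real measure.
        (\<forall>\<tau>>0. K \<tau> \<in> borel \<rightarrow>\<^sub>M prob_algebra borel) \<and>
        (\<forall>s t B. s < t \<longrightarrow> B \<in> sets borel \<longrightarrow>
           (AE \<omega> in M. real_cond_exp M (gen_sigma M X {s}) (indicator (X t -` B \<inter> space M)) \<omega> =
                       measure (K (t - s) (X s \<omega>)) B)))"

definition moment_determinate :: "real measure \<Rightarrow> bool" where
  "moment_determinate \<mu> \<longleftrightarrow>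
     (\<forall>n::nat. integrable \<mu> (\<lambda>x. x ^ n)) \<and>
     (\<forall>\<nu>. prob_space \<nu> \<longrightarrow> sets \<nu> = sets borel \<longrightarrow>
        (\<forall>n::nat. integrable \<nu> (\<lambda>x. x ^ n) \<and> (\<integral>x. x ^ n \<partial>\<nu>) = (\<integral>x. x ^ n \<partial>\<mu>)) \<longrightarrow> \<nu> = \<mu>)"

definition num_support :: "'a measure \<Rightarrow> (real \<Rightarrow> 'a \<Rightarrow> real) \<Rightarrow> enat" where
  "num_support M X = ecard (measure_support (distr M borel (X 0)))"

definition totally_linearly_dependent :: "'a measure \<Rightarrow> (real \<Rightarrow> 'a \<Rightarrow> real) \<Rightarrow> bool" where
  "totally_linearly_dependent M X \<longleftrightarrow>
     (\<forall>n (s :: nat \<Rightarrow> real). 0 < n \<longrightarrow> enat n \<le> num_support M X - 1 \<longrightarrow> inj_on s {..<n} \<longrightarrow>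
        invertible_mat (mat n n (\<lambda>(i, j). covariance M (X (s i)) (X (s j)))))"

definition mean_square_continuous :: "'a measure \<Rightarrow> (real \<Rightarrow> 'a \<Rightarrow> real) \<Rightarrow> bool" where
  "mean_square_continuous M X \<longleftrightarrow>
     (\<forall>m j :: nat. \<exists>g :: real \<Rightarrow> real.
        (\<forall>s t. (\<integral>\<omega>. X t \<omega> ^ m * X s \<omega> ^ j \<partial>M) = g \<bar>t - s\<bar>) \<and> continuous (at 0 within {0..}) g)"

definition polynomial_regression ::
    "'a measure \<Rightarrow> (real \<Rightarrow> 'a \<Rightarrow> real) \<Rightarrow> (nat \<Rightarrow> nat \<Rightarrow> real \<Rightarrow> real) \<Rightarrow> bool" where
  "polynomial_regression M X \<gamma> \<longleftrightarrow>
     (\<forall>n. 1 \<le> n \<longrightarrow> enat n < num_support M X \<longrightarrow>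
        (\<forall>\<tau>>0. \<gamma> n n \<tau> \<noteq> 0) \<and>
        (\<forall>s t. s < t \<longrightarrow>
           (AE \<omega> in M. real_cond_exp M (gen_sigma M X {..s}) (\<lambda>\<omega>. X t \<omega> ^ n) \<omega> =
                       (\<Sum>j\<le>n. \<gamma> n j (t - s) * X s \<omega> ^ j))))"

definition structural_mat :: "(nat \<Rightarrow> nat \<Rightarrow> real \<Rightarrow> real) \<Rightarrow> nat \<Rightarrow> real \<Rightarrow> real mat" where
  "structural_mat \<gamma> n t = mat (n + 1) (n + 1) (\<lambda>(i, j). if j \<le> i then \<gamma> i j t else 0)"

definition diagonalizable_mat :: "'b::semiring_1 mat \<Rightarrow> bool" where
  "diagonalizable_mat A \<longleftrightarrow> (\<exists>D. diagonal_mat D \<and> similar_mat A D)"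

definition smpr :: "'a measure \<Rightarrow> (real \<Rightarrow> 'a \<Rightarrow> real) \<Rightarrow> bool" where
  "smpr M X \<longleftrightarrow>
     prob_space M \<and> markov_process M X \<and> stationary M X \<and>
     moment_determinate (distr M borel (X 0)) \<and>
     totally_linearly_dependent M X \<and> mean_square_continuous M X \<and>
     (\<exists>\<gamma>. (\<forall>\<tau>. \<gamma> 0 0 \<tau> = 1) \<and> polynomial_regression M X \<gamma> \<and>
        (\<forall>n. enat n < num_support M X \<longrightarrow> (\<forall>t>0. diagonalizable_mat (structural_mat \<gamma> n t))))"

definition regression_eigenpolys ::
    "'a measure \<Rightarrow> (real \<Rightarrow> 'a \<Rightarrow> real) \<Rightarrow> (nat \<Rightarrow> real) \<Rightarrow> (nat \<Rightarrow> real poly) \<Rightarrow> bool" where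
  "regression_eigenpolys M X \<alpha> p \<longleftrightarrow>
     \<alpha> 0 = 0 \<and>
     (\<forall>n. enat n < num_support M X \<longrightarrow>
        degree (p n) = n \<and> lead_coeff (p n) = 1 \<and>
        (\<forall>s t. s < t \<longrightarrow>
           (AE \<omega> in M. real_cond_exp M (gen_sigma M X {..s}) (\<lambda>\<omega>. poly (p n) (X t \<omega>)) \<omega> =
                       exp (- \<alpha> n * (t - s)) * poly (p n) (X s \<omega>))))"

text \<open>
  The correlation indices \<open>\<alpha>\<close> are determined by the process, but the monic eigenpolynomials \<open>p\<close>
  need not be when two indices coincide; regularity refers to a given choice.
\<close>

definition rsmpr ::
    "'a measure \<Rightarrow> (real \<Rightarrow> 'a \<Rightarrow> real) \<Rightarrow> (nat \<Rightarrow> real) \<Rightarrow> (nat \<Rightarrow> real poly) \<Rightarrow> bool" where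
  "rsmpr M X \<alpha> p \<longleftrightarrow>
     smpr M X \<and> regression_eigenpolys M X \<alpha> p \<and>
     (\<forall>m n. m \<noteq> n \<longrightarrow> enat m < num_support M X \<longrightarrow> enat n < num_support M X \<longrightarrow>
        (\<integral>\<omega>. poly (p m) (X 0 \<omega>) * poly (p n) (X 0 \<omega>) \<partial>M) = 0)"

definition normalized_poly ::
    "'a measure \<Rightarrow> (real \<Rightarrow> 'a \<Rightarrow> real) \<Rightarrow> (nat \<Rightarrow> real poly) \<Rightarrow> nat \<Rightarrow> real poly" where
  "normalized_poly M X p n = Polynomial.smult (1 / sqrt (\<integral>\<omega>. (poly (p n) (X 0 \<omega>))\<^sup>2 \<partial>M)) (p n)"

definition independent_regression :: "'a measure \<Rightarrow> (real \<Rightarrow> 'a \<Rightarrow> real) \<Rightarrow> bool" where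
  "independent_regression M X \<longleftrightarrow>
     (\<forall>s t. \<forall>j::nat. s < t \<longrightarrow> 1 \<le> j \<longrightarrow>
        (\<exists>c. AE \<omega> in M. real_cond_exp M (gen_sigma M X {..s})
           (\<lambda>\<omega>. (X t \<omega> - real_cond_exp M (gen_sigma M X {..s}) (X t) \<omega>) ^ j) \<omega> = c))"


section \<open>Harnesses, independent increments, Ornstein--Uhlenbeck processes\<close>

definition harness_on :: "'a measure \<Rightarrow> real set \<Rightarrow> (real \<Rightarrow> 'a \<Rightarrow> real) \<Rightarrow> bool" where
  "harness_on M T Y \<longleftrightarrow>
     (\<forall>t\<in>T. integrable M (Y t)) \<and>
     (\<forall>s\<in>T. \<forall>t\<in>T. \<forall>u\<in>T. s < t \<longrightarrow> t < u \<longrightarrow>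
        (\<exists>a b c. (a \<noteq> 0 \<or> b \<noteq> 0) \<and>
           (AE \<omega> in M. real_cond_exp M (gen_sigma M Y (T - {s<..<u})) (Y t) \<omega> =
                       a * Y s \<omega> + b * Y u \<omega> + c)))"

definition independent_increments_on :: "'a measure \<Rightarrow> real set \<Rightarrow> (real \<Rightarrow> 'a \<Rightarrow> real) \<Rightarrow> bool" where
  "independent_increments_on M T Y \<longleftrightarrow>
     (\<forall>n (t :: nat \<Rightarrow> real). (\<forall>i\<le>n. t i \<in> T) \<longrightarrow> (\<forall>i<n. t i < t (Suc i)) \<longrightarrow>
        prob_space.indep_vars M (\<lambda>_. borel) (\<lambda>i \<omega>. Y (t (Suc i)) \<omega> - Y (t i) \<omega>) {..<n})"

definition levy_process :: "'a measure \<Rightarrow> (real \<Rightarrow> 'a \<Rightarrow> real) \<Rightarrow> bool" where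
  "levy_process M Y \<longleftrightarrow>
     (AE \<omega> in M. Y 0 \<omega> = 0) \<and>
     independent_increments_on M {0..} Y \<and>
     (\<forall>\<sigma> \<tau>. 0 \<le> \<sigma> \<longrightarrow> \<sigma> \<le> \<tau> \<longrightarrow>
        distr M borel (\<lambda>\<omega>. Y \<tau> \<omega> - Y \<sigma> \<omega>) = distr M borel (Y (\<tau> - \<sigma>)))"

definition gaussian_process :: "'a measure \<Rightarrow> ('i \<Rightarrow> 'a \<Rightarrow> real) \<Rightarrow> bool" where
  "gaussian_process M X \<longleftrightarrow>
     (\<forall>i. X i \<in> borel_measurable M) \<and>
     (\<forall>J (c :: 'i \<Rightarrow> real). finite J \<longrightarrow>
        (\<exists>m. (AE \<omega> in M. (\<Sum>i\<in>J. c i * X i \<omega>) = m) \<or>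
             (\<exists>\<sigma>>0. distributed M lborel (\<lambda>\<omega>. \<Sum>i\<in>J. c i * X i \<omega>)
                       (\<lambda>x. ennreal (normal_density m \<sigma> x)))))"

text \<open>
  Stationarity is here the same Markovian notion as above; a centered Gaussian process with this
  covariance is Markov and strictly stationary.
\<close>

definition ornstein_uhlenbeck :: "'a measure \<Rightarrow> (real \<Rightarrow> 'a \<Rightarrow> real) \<Rightarrow> bool" where
  "ornstein_uhlenbeck M X \<longleftrightarrow>
     stationary M X \<and> gaussian_process M X \<and>
     (\<forall>t. integrable M (X t) \<and> (\<integral>\<omega>. X t \<omega> \<partial>M) = 0) \<and>
     (\<exists>\<sigma>>0. \<exists>\<alpha>>0. \<forall>s t. covariance M (X t) (X s) = \<sigma>\<^sup>2 * exp (- \<alpha> * \<bar>t - s\<bar>))"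

text \<open>The monic (probabilists') Hermite polynomials, orthogonal for the standard normal law.\<close>

fun hermite_poly :: "nat \<Rightarrow> real poly" where
  "hermite_poly 0 = 1"
| "hermite_poly (Suc 0) = [:0, 1:]"
| "hermite_poly (Suc (Suc n)) =
     [:0, 1:] * hermite_poly (Suc n) - Polynomial.smult (real (Suc n)) (hermite_poly n)"

text \<open>The factor \<open>1 / sqrt n!\<close> is the one that makes them orthonormal for \<open>N(0, c\<^sup>2)\<close>.\<close>

definition scaled_hermite_upto :: "enat \<Rightarrow> (nat \<Rightarrow> real poly) \<Rightarrow> bool" where
  "scaled_hermite_upto v h \<longleftrightarrow>
     (\<exists>c>0. \<forall>n. enat n < v \<longrightarrow>
        h n = Polynomial.smult (1 / sqrt (fact n)) (pcompose (hermite_poly n) [:0, 1 / c:]))"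

text \<open>The value at time \<open>0\<close> is the usual convention for processes started at the origin.\<close>

definition lamperti :: "real \<Rightarrow> (real \<Rightarrow> 'a \<Rightarrow> real) \<Rightarrow> real \<Rightarrow> 'a \<Rightarrow> real" where
  "lamperti \<alpha>1 X \<tau> \<omega> = (if \<tau> > 0 then sqrt \<tau> * X (ln \<tau> / (2 * \<alpha>1)) \<omega> else 0)"

text \<open>
  Only the coefficients \<open>\<kappa> j\<close> with \<open>j \<ge> 2\<close> matter; the sums are shifted by two.
\<close>

definition has_mgf_exp_series :: "'a measure \<Rightarrow> ('a \<Rightarrow> real) \<Rightarrow> (nat \<Rightarrow> real) \<Rightarrow> real \<Rightarrow> bool" where
  "has_mgf_exp_series M Z \<kappa> r \<longleftrightarrow>
     (\<forall>y. \<bar>y\<bar> < r \<longrightarrow>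
        integrable M (\<lambda>\<omega>. exp (y * Z \<omega>)) \<and>
        summable (\<lambda>j. \<kappa> (j + 2) * y ^ (j + 2) / fact (j + 2)) \<and>
        (\<integral>\<omega>. exp (y * Z \<omega>) \<partial>M) = exp (\<Sum>j. \<kappa> (j + 2) * y ^ (j + 2) / fact (j + 2)))"

end

theory Submission
  imports Defs "HOL-Complex_Analysis.Conformal_Mappings"
begin

text \<open>
  Independent regression says that the moments of the innovation \<open>X\<^sub>t - \<rho>X\<^sub>s\<close>, \<open>\<rho> = exp (s - t)\<close>,
  are the same on every event of the past. As the innovation has exponential moments, it is
  independent of the past, which gives the independent increments of \<open>Y\<close> and the generating functions.

  Orthogonality of the eigenpolynomials moreover gives the reversed regression
  \<open>E (X\<^sub>s q(X\<^sub>t)) = \<rho> E (X\<^sub>t q(X\<^sub>t))\<close> for all polynomials \<open>q\<close>. Together with independence of the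
  innovation this reads \<open>\<psi>'(\<rho>y) = \<rho>\<psi>'(y)\<close> for \<open>\<psi> = ln E exp (yX\<^sub>0)\<close> and all \<open>\<rho> < 1\<close>, so \<open>\<psi>\<close> is
  quadratic and \<open>X\<close> is always an Ornstein--Uhlenbeck process. Hence \<open>Y\<close> is a Brownian motion up to
  scale, and \<open>Y\<^sub>t\<close> minus its linear interpolation between \<open>Y\<^sub>s\<close> and \<open>Y\<^sub>u\<close> is uncorrelated with, hence
  independent of, the values of \<open>Y\<close> outside \<open>(s, u)\<close>. The monic orthogonal polynomials of the Gaussian law are the Hermite polynomials.
\<close>

section \<open>Integrals of exponentials and uniqueness of weighted laws\<close>

text \<open>Equal moments do not give independence in general. For the weight \<open>K\<close>, the
  indicator of a past event minus its probability, exponential moments make the transform of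
  \<open>K\<close> holomorphic on a vertical strip. Its Taylor coefficients at 0 vanish, so it
  vanishes on the strip and hence on the imaginary axis, where uniqueness of characteristic
  functions applies. This is why integrals with signed and complex weights are studied.

  The reversed regression needs eigenpolynomials of every degree, but these exist only below the
  number of support points. Finite support must therefore be excluded before orthogonality can be
  used; this is done by looking at the largest atom of the stationary law.

  The equation for psi' comes from computing E (X_s exp (y X_t)) in two ways, by independence of the
  innovation and by reversed regression. It is obtained for real arguments near 0 only; analytic
  continuation of the resulting equation F' = k z F carries it to the characteristic
  function.\<close>

lemma exp_integral_power_series:
  fixes K :: "'a \<Rightarrow> complex" and V :: "'a \<Rightarrow> real" and h :: complex
  assumes [measurable]: "K \<in> borel_measurable M" "V \<in> borel_measurable M"
    and int: "integrable M (\<lambda>x. norm (K x) * exp (norm h * \<bar>V x\<bar>))"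
  shows "(\<lambda>j. (\<integral>x. K x * of_real (V x) ^ j \<partial>M) / fact j * h ^ j) sums
           (\<integral>x. K x * exp (h * of_real (V x)) \<partial>M)"
    (is "?c sums ?F")
proof -
  let ?t = "\<lambda>j x. K x * of_real (V x) ^ j / fact j * h ^ j"
  let ?s = "\<lambda>n x. \<Sum>j<n. ?t j x"
  have norm_t: "norm (?t j x) = norm (K x) * ((norm h * \<bar>V x\<bar>) ^ j /\<^sub>R fact j)" for j x
    by (simp add: norm_mult norm_divide norm_inverse norm_power power_mult_distrib divide_inverse)
  have exp_sums: "(\<lambda>j. (norm h * \<bar>V x\<bar>) ^ j /\<^sub>R fact j) sums exp (norm h * \<bar>V x\<bar>)" for x
    by (rule exp_converges)
  have bound: "norm (?t j x) \<le> norm (K x) * exp (norm h * \<bar>V x\<bar>)" for j x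
    unfolding norm_t
    using sum_le_suminf[OF sums_summable[OF exp_sums[of x]], of "{j}"] sums_unique[OF exp_sums[of x]]
    by (intro mult_left_mono) auto
  have int_t: "integrable M (?t j)" for j
    by (rule Bochner_Integration.integrable_bound[OF int]) (use bound in auto)
  \<comment> \<open>Dominated convergence: the hypothesis \<open>int\<close> supplies the majorant
    of all partial sums.\<close>
  have "(\<lambda>n. \<integral>x. ?s n x \<partial>M) \<longlonglongrightarrow> ?F"
  proof (rule integral_dominated_convergence[OF _ _ int])
    show "AE x in M. (\<lambda>n. ?s n x) \<longlonglongrightarrow> K x * exp (h * of_real (V x))"
    proof (rule AE_I2)
      fix x
      have "(\<lambda>j. (h * of_real (V x)) ^ j /\<^sub>R fact j) sums exp (h * of_real (V x))"
        by (rule exp_converges)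
      from sums_mult[OF this, of "K x"]
      have "(\<lambda>j. ?t j x) sums (K x * exp (h * of_real (V x)))"
        by (simp add: power_mult_distrib scaleR_conv_of_real divide_inverse mult_ac)
      then show "(\<lambda>n. ?s n x) \<longlonglongrightarrow> K x * exp (h * of_real (V x))"
        by (simp add: sums_def)
    qed
    fix n
    have "norm (?s n x) \<le> norm (K x) * exp (norm h * \<bar>V x\<bar>)" for x
    proof -
      have "norm (?s n x) \<le> (\<Sum>j<n. norm (?t j x))" by (rule norm_sum)
      also have "\<dots> = norm (K x) * (\<Sum>j<n. (norm h * \<bar>V x\<bar>) ^ j /\<^sub>R fact j)"
        unfolding norm_t by (simp add: sum_distrib_left)
      also have "\<dots> \<le> norm (K x) * exp (norm h * \<bar>V x\<bar>)"
        using sum_le_suminf[OF sums_summable[OF exp_sums[of x]], of "{..<n}"]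
          sums_unique[OF exp_sums[of x]]
        by (intro mult_left_mono) auto
      finally show ?thesis .
    qed
    then show "AE x in M. norm (?s n x) \<le> norm (K x) * exp (norm h * \<bar>V x\<bar>)" by simp
  qed measurable
  moreover have "(\<integral>x. ?s n x \<partial>M) = (\<Sum>j<n. ?c j)" for n
  proof -
    have "(\<integral>x. ?t j x \<partial>M) = ?c j" for j
    proof -
      have "?t j = (\<lambda>x. (h ^ j / fact j) * (K x * of_real (V x) ^ j))" by (simp add: mult_ac)
      then show ?thesis by (simp only: integral_mult_right_zero) (simp add: mult_ac)
    qed
    then show ?thesis using int_t by (subst Bochner_Integration.integral_sum) auto
  qed
  ultimately show ?thesis by (simp add: sums_def)
qed

text \<open>Since exp ((z + h) V) = exp (z V) exp (h V), the power series lemma with weight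
  \<open>K x * exp (z * of_real (V x))\<close> expands the integral around \<open>z\<close>, and the
  derivative is the linear coefficient.\<close>

lemma exp_integral_has_field_derivative:
  fixes K :: "'a \<Rightarrow> complex" and V :: "'a \<Rightarrow> real" and z :: complex
  assumes [measurable]: "K \<in> borel_measurable M" "V \<in> borel_measurable M"
    and int: "integrable M (\<lambda>x. norm (K x) * exp (r * \<bar>V x\<bar>))"
    and z: "\<bar>Re z\<bar> < r"
  shows "((\<lambda>z. \<integral>x. K x * exp (z * of_real (V x)) \<partial>M) has_field_derivative
           (\<integral>x. K x * of_real (V x) * exp (z * of_real (V x)) \<partial>M)) (at z)"
proof -
  let ?K = "\<lambda>x. K x * exp (z * of_real (V x))"
  define c where "c j = (\<integral>x. ?K x * of_real (V x) ^ j \<partial>M) / fact j" for j :: nat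
  \<comment> \<open>The new weight at \<open>z\<close> uses up |Re z| of the exponential radius
    \<open>r\<close>.\<close>
  define r' where "r' = r - \<bar>Re z\<bar>"
  have "r' > 0" using z by (simp add: r'_def)
  have int': "integrable M (\<lambda>x. norm (?K x) * exp (norm h * \<bar>V x\<bar>))" if "norm h < r'" for h :: complex
  proof (rule Bochner_Integration.integrable_bound[OF int])
    show "AE x in M. norm (norm (?K x) * exp (norm h * \<bar>V x\<bar>)) \<le> norm (norm (K x) * exp (r * \<bar>V x\<bar>))"
    proof (rule AE_I2)
      fix x
      have "Re z * V x + norm h * \<bar>V x\<bar> \<le> \<bar>Re z\<bar> * \<bar>V x\<bar> + norm h * \<bar>V x\<bar>"
        using abs_ge_self[of "Re z * V x"] by (simp add: abs_mult)
      also have "\<dots> = (\<bar>Re z\<bar> + norm h) * \<bar>V x\<bar>" by (simp add: algebra_simps)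
      also have "\<dots> \<le> r * \<bar>V x\<bar>"
        using that by (intro mult_right_mono) (auto simp: r'_def)
      finally show "norm (norm (?K x) * exp (norm h * \<bar>V x\<bar>)) \<le> norm (norm (K x) * exp (r * \<bar>V x\<bar>))"
        by (simp add: norm_mult mult.assoc mult_left_mono flip: exp_add)
    qed
  qed measurable
  have sums: "(\<lambda>j. c j * h ^ j) sums (\<integral>x. K x * exp ((z + h) * of_real (V x)) \<partial>M)"
    if "norm h < r'" for h
    using exp_integral_power_series[of ?K M V h, OF _ _ int'[OF that]]
    by (simp add: c_def distrib_right exp_add mult.assoc)
  have "((\<lambda>h. \<Sum>j. c j * h ^ j) has_field_derivative (\<Sum>j. diffs c j * 0 ^ j)) (at 0)"
    by (rule termdiffs_strong'[of r']) (use sums sums_summable \<open>r' > 0\<close> in auto)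
  also have "(\<Sum>j. diffs c j * 0 ^ j) = c 1"
    by (simp add: diffs_def)
  finally have "((\<lambda>h. \<integral>x. K x * exp ((z + h) * of_real (V x)) \<partial>M) has_field_derivative c 1) (at 0)"
    by (rule has_field_derivative_transform_within_open[of _ _ _ "ball 0 r'"])
      (use sums \<open>r' > 0\<close> in \<open>auto dest: sums_unique[symmetric]\<close>)
  then have "((\<lambda>w. \<integral>x. K x * exp (w * of_real (V x)) \<partial>M) has_field_derivative c 1) (at (0 + z))"
    unfolding DERIV_shift by (simp add: add.commute)
  then show ?thesis by (simp add: c_def mult.assoc mult.commute mult.left_commute)
qed

text \<open>Split the weight into positive and negative part. At u = 0 the hypothesis shows that
  both have the same mass. Normalised, they are two densities under which \<open>Z\<close> has the
  same characteristic function, so Levy's uniqueness theorem applies.\<close>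

lemma real_integral_indicator_eq_0_of_char:
  fixes K :: "'a \<Rightarrow> real" and Z :: "'a \<Rightarrow> real"
  assumes K: "integrable M K" and [measurable]: "Z \<in> borel_measurable M"
    and char: "\<And>u. (\<integral>x. K x * iexp (u * Z x) \<partial>M) = 0"
    and B: "B \<in> sets borel"
  shows "(\<integral>x. K x * indicator (Z -` B) x \<partial>M) = 0"
proof -
  have [measurable]: "K \<in> borel_measurable M" "B \<in> sets borel" using K B by auto
  define P where "P x = max 0 (K x)" for x
  define N where "N x = max 0 (- K x)" for x
  have [measurable]: "P \<in> borel_measurable M" "N \<in> borel_measurable M"
    unfolding P_def[abs_def] N_def[abs_def] by measurable
  have P: "integrable M P" and N: "integrable M N"
    by (auto simp: P_def[abs_def] N_def[abs_def] intro!: integrable_max K integrable_minus)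
  have nonneg: "P x \<ge> 0" "N x \<ge> 0" and KPN: "K x = P x - N x" for x
    by (auto simp: P_def N_def)
  define c where "c = (\<integral>x. P x \<partial>M)"
  have eq: "(\<integral>x. P x * iexp (u * Z x) \<partial>M) = (\<integral>x. N x * iexp (u * Z x) \<partial>M)" for u
  proof -
    have "integrable M (\<lambda>x. f x * iexp (u * Z x))" if "integrable M f" for f :: "'a \<Rightarrow> real"
      by (rule Bochner_Integration.integrable_bound[OF that]) (use that in \<open>auto simp: norm_mult\<close>)
    then show ?thesis using char[of u] P N by (simp add: KPN left_diff_distrib)
  qed
  have "complex_of_real (\<integral>x. P x \<partial>M) = complex_of_real (\<integral>x. N x \<partial>M)"
    using eq[of 0] by (simp add: integral_complex_of_real)
  then have cN: "c = (\<integral>x. N x \<partial>M)" by (simp add: c_def del: integral_complex_of_real)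
  show ?thesis
  \<comment> \<open>Mass 0 cannot be normalised, but then the weight is 0 almost everywhere.\<close>
  proof (cases "c = 0")
    case True
    have "AE x in M. P x = 0" "AE x in M. N x = 0"
      using integral_nonneg_eq_0_iff_AE[OF P] integral_nonneg_eq_0_iff_AE[OF N] True cN nonneg
      by (auto simp: c_def)
    then have "AE x in M. K x * indicator (Z -` B) x = 0"
      by eventually_elim (simp add: KPN)
    then show ?thesis by (simp add: integral_eq_zero_AE)
  next
    case False
    then have c: "c > 0" using nonneg by (simp add: c_def less_le)
    define D where "D f = distr (density M (\<lambda>x. ennreal (f x / c))) borel Z" for f :: "'a \<Rightarrow> real"
    have D_int: "(\<integral>y. g y \<partial>D f) = (\<integral>x. (f x / c) *\<^sub>R g (Z x) \<partial>M)"
      if [measurable]: "f \<in> borel_measurable M" "g \<in> borel_measurable borel" and "\<And>x. f x \<ge> 0"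
      for f and g :: "real \<Rightarrow> 'b::{banach, second_countable_topology}"
      unfolding D_def using c that by (subst integral_distr; simp) (subst integral_density; simp)
    have D_real: "real_distribution (D f)"
      if "integrable M f" "\<And>x. f x \<ge> 0" "(\<integral>x. f x \<partial>M) = c" for f
    proof -
      have [measurable]: "f \<in> borel_measurable M" using that by auto
      have "emeasure (density M (\<lambda>x. ennreal (f x / c))) (space M) = (\<integral>\<^sup>+x. ennreal (f x / c) \<partial>M)"
        by (simp add: emeasure_density cong: nn_integral_cong)
      also have "\<dots> = ennreal (\<integral>x. f x / c \<partial>M)"
        using that c by (intro nn_integral_eq_integral) auto
      also have "\<dots> = 1" using that c by simp
      finally have "prob_space (density M (\<lambda>x. ennreal (f x / c)))"
        by (intro prob_spaceI) simp
      then show ?thesis unfolding D_def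
        by (intro prob_space.real_distribution_distr) auto
    qed
    have "char (D f) u = (\<integral>x. f x * iexp (u * Z x) \<partial>M) / c"
      if "f \<in> borel_measurable M" "\<And>x. f x \<ge> 0" for f u
      unfolding char_def using that
      by (subst D_int) (auto simp: scaleR_conv_of_real)
    then have "char (D P) = char (D N)" using eq nonneg by (auto simp: fun_eq_iff)
    then have "D P = D N"
      by (intro Levy_uniqueness D_real) (use P N nonneg cN c_def in auto)
    then have "(\<integral>y. indicator B y \<partial>D P) = (\<integral>y. indicator B y \<partial>D N :: real)" by simp
    moreover have "(\<integral>y. indicator B y \<partial>D f) = (\<integral>x. f x * indicator (Z -` B) x \<partial>M) / c"
      if "f \<in> borel_measurable M" "\<And>x. f x \<ge> 0" for f
      by (subst D_int) (use that in \<open>auto simp: indicator_def[of _ "Z _"] indicator_def[of "Z -` B"]\<close>)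
    ultimately have "(\<integral>x. P x * indicator (Z -` B) x \<partial>M) = (\<integral>x. N x * indicator (Z -` B) x \<partial>M)"
      using nonneg c by simp
    moreover have "integrable M (\<lambda>x. f x * indicator (Z -` B) x)" if "integrable M f" for f :: "'a \<Rightarrow> real"
    proof (rule Bochner_Integration.integrable_bound[OF that])
      have "(\<lambda>x. f x * indicator B (Z x)) \<in> borel_measurable M" using that by measurable
      then show "(\<lambda>x. f x * indicator (Z -` B) x) \<in> borel_measurable M"
        by (simp add: indicator_def)
    qed (auto simp: indicator_def)
    ultimately show ?thesis using P N by (simp add: KPN left_diff_distrib)
  qed
qed

text \<open>Real and imaginary part of the weight are linear combinations of \<open>K\<close> and
  \<open>cnj K\<close>, and the transform of \<open>cnj K\<close> at u is the conjugate of the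
  transform of \<open>K\<close> at -u.\<close>

lemma integral_indicator_eq_0_of_char:
  fixes K :: "'a \<Rightarrow> complex" and Z :: "'a \<Rightarrow> real"
  assumes K: "integrable M K" and [measurable]: "Z \<in> borel_measurable M"
    and char: "\<And>u. (\<integral>x. K x * iexp (u * Z x) \<partial>M) = 0"
    and B: "B \<in> sets borel"
  shows "(\<integral>x. K x * indicator (Z -` B) x \<partial>M) = 0"
proof -
  have [measurable]: "K \<in> borel_measurable M" "B \<in> sets borel" using K B by auto
  have int: "integrable M (\<lambda>x. L x * iexp (u * Z x))" if "integrable M L" for L u
    by (rule Bochner_Integration.integrable_bound[OF that]) (use that in \<open>auto simp: norm_mult\<close>)
  have cnj: "(\<integral>x. cnj (K x) * iexp (u * Z x) \<partial>M) = 0" for u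
  proof -
    have "(\<integral>x. cnj (K x) * iexp (u * Z x) \<partial>M) = (\<integral>x. cnj (K x * iexp ((-u) * Z x)) \<partial>M)"
      by (simp add: exp_cnj)
    also have "\<dots> = 0" unfolding Bochner_Integration.integral_cnj char by simp
    finally show ?thesis .
  qed
  have iK: "integrable M (\<lambda>x. cnj (K x))" using K by simp
  have zero: "(\<integral>x. (a * K x + b * cnj (K x)) * iexp (u * Z x) \<partial>M) = 0" for a b u
  proof -
    have "(\<integral>x. (a * K x + b * cnj (K x)) * iexp (u * Z x) \<partial>M)
        = (\<integral>x. a * (K x * iexp (u * Z x)) + b * (cnj (K x) * iexp (u * Z x)) \<partial>M)"
      by (intro Bochner_Integration.integral_cong) (auto simp: distrib_right mult.assoc)
    also have "\<dots> = 0"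
      by (subst Bochner_Integration.integral_add)
        (use int[OF K, of u] int[OF iK, of u] char[of u] cnj[of u] in
          \<open>simp_all only: integrable_mult_right integral_mult_right_zero mult_zero_right add_0\<close>)
    finally show ?thesis .
  qed
  have "complex_of_real (Re (K x)) = 1/2 * K x + 1/2 * cnj (K x)"
    and "complex_of_real (Im (K x)) = (-\<i>/2) * K x + (\<i>/2) * cnj (K x)" for x
    by (simp_all add: complex_eq_iff)
  then have 1: "(\<integral>x. complex_of_real (Re (K x)) * iexp (u * Z x) \<partial>M) = 0"
    and 2: "(\<integral>x. complex_of_real (Im (K x)) * iexp (u * Z x) \<partial>M) = 0" for u
    by (simp_all only: zero)
  have ind: "integrable M (\<lambda>x. K x * indicator (Z -` B) x)"
  proof (rule Bochner_Integration.integrable_bound[OF K])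
    have "(\<lambda>x. K x * indicator B (Z x)) \<in> borel_measurable M" by measurable
    then show "(\<lambda>x. K x * indicator (Z -` B) x) \<in> borel_measurable M"
      by (simp add: indicator_def)
  qed (auto simp: indicator_def)
  show ?thesis
  proof (rule complex_eqI)
    have "Re (\<integral>x. K x * indicator (Z -` B) x \<partial>M) = (\<integral>x. Re (K x) * indicator (Z -` B) x \<partial>M)"
      unfolding integral_Re[OF ind, symmetric]
      by (intro Bochner_Integration.integral_cong) (auto simp: indicator_def)
    then show "Re (\<integral>x. K x * indicator (Z -` B) x \<partial>M) = Re 0"
      using real_integral_indicator_eq_0_of_char[OF integrable_Re[OF K] _ 1 B] by simp
    have "Im (\<integral>x. K x * indicator (Z -` B) x \<partial>M) = (\<integral>x. Im (K x) * indicator (Z -` B) x \<partial>M)"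
      unfolding integral_Im[OF ind, symmetric]
      by (intro Bochner_Integration.integral_cong) (auto simp: indicator_def)
    then show "Im (\<integral>x. K x * indicator (Z -` B) x \<partial>M) = Im 0"
      using real_integral_indicator_eq_0_of_char[OF integrable_Im[OF K] _ 2 B] by simp
  qed
qed

section \<open>Independence from moments and from characters\<close>

lemma space_gen_sigma [simp]: "space (gen_sigma M X I) = space M"
  by (auto simp: gen_sigma_def intro!: space_measure_of)

lemma sets_gen_sigma:
  "sets (gen_sigma M X I) =
     sigma_sets (space M) {X i -` B \<inter> space M | i B. i \<in> I \<and> B \<in> sets borel}"
  by (auto simp: gen_sigma_def intro!: sets_measure_of)

lemma measurable_gen_sigma: "i \<in> I \<Longrightarrow> X i \<in> borel_measurable (gen_sigma M X I)"
  by (auto simp: measurable_def sets_gen_sigma intro!: sigma_sets.Basic)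

lemma subalgebra_gen_sigma:
  assumes "\<And>i. i \<in> I \<Longrightarrow> X i \<in> borel_measurable M"
  shows "subalgebra M (gen_sigma M X I)"
  unfolding subalgebra_def sets_gen_sigma space_gen_sigma
  using assms by (auto intro!: sets.sigma_sets_subset measurable_sets)

text \<open>A single term of the exponential series bounds the power.\<close>

lemma integrable_power_of_exp_abs:
  fixes V :: "'a \<Rightarrow> real"
  assumes [measurable]: "V \<in> borel_measurable M" and r: "r > 0"
    and int: "integrable M (\<lambda>x. exp (r * \<bar>V x\<bar>))"
  shows "integrable M (\<lambda>x. V x ^ j)"
proof -
  have "exp (r * \<bar>v\<bar>) \<ge> r ^ j * \<bar>v\<bar> ^ j / fact j" for v
    using sum_le_suminf[OF sums_summable[OF exp_converges[of "r * \<bar>v\<bar>"]], of "{j}"] r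
      sums_unique[OF exp_converges[of "r * \<bar>v\<bar>"]]
    by (auto simp: power_mult_distrib divide_inverse mult_ac)
  then have "\<bar>v\<bar> ^ j \<le> fact j / r ^ j * exp (r * \<bar>v\<bar>)" for v
    using r by (simp add: field_simps)
  then show ?thesis
    by (intro Bochner_Integration.integrable_bound[OF integrable_mult_right[OF int, of "fact j / r ^ j"]])
      (use r in \<open>auto simp: power_abs abs_mult intro!: AE_I2\<close>)
qed

context prob_space
begin

text \<open>The integral of the weight \<open>indicator A x - prob A\<close> over a preimage under
  \<open>V\<close> is exactly the defect in the product rule.\<close>

lemma prob_inter_of_char:
  assumes A [measurable]: "A \<in> events" and V [measurable]: "random_variable borel V"
    and char: "\<And>u. (\<integral>x. (indicator A x - prob A) * iexp (u * V x) \<partial>M) = 0"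
    and B [measurable]: "B \<in> sets borel"
  shows "prob (A \<inter> (V -` B \<inter> space M)) = prob A * prob (V -` B \<inter> space M)"
proof -
  let ?B = "V -` B \<inter> space M"
  have [measurable]: "?B \<in> events" by measurable
  have "integrable M (\<lambda>x. indicator A x - prob A :: real)"
    by (intro Bochner_Integration.integrable_diff) (auto simp: less_top[symmetric])
  then have "(\<integral>x. (indicator A x - prob A) * indicator (V -` B) x \<partial>M) = (0::real)"
    using char
    by (intro real_integral_indicator_eq_0_of_char B) auto
  also have "(\<integral>x. (indicator A x - prob A) * indicator (V -` B) x \<partial>M)
      = (\<integral>x. indicator (A \<inter> ?B) x - prob A * indicator ?B x \<partial>M)"
    by (intro Bochner_Integration.integral_cong) (auto simp: indicator_def)
  also have "\<dots> = prob (A \<inter> ?B) - prob A * prob ?B"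
    by (subst Bochner_Integration.integral_diff) (auto simp: emeasure_eq_measure)
  finally show ?thesis by simp
qed

lemma prob_inter_of_moments:
  assumes A [measurable]: "A \<in> events" and V [measurable]: "random_variable borel V"
    and r: "r > 0" and int: "integrable M (\<lambda>x. exp (r * \<bar>V x\<bar>))"
    and moments: "\<And>j. (\<integral>x. indicator A x * V x ^ j \<partial>M) = prob A * (\<integral>x. V x ^ j \<partial>M)"
    and B: "B \<in> sets borel"
  shows "prob (A \<inter> (V -` B \<inter> space M)) = prob A * prob (V -` B \<inter> space M)"
proof (rule prob_inter_of_char[OF A V _ B])
  define K :: "'a \<Rightarrow> real" where "K x = indicator A x - prob A" for x
  define F where "F z = (\<integral>x. complex_of_real (K x) * exp (z * of_real (V x)) \<partial>M)" for z
  define S where "S = {z. \<bar>Re z\<bar> < r}"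
  have [measurable]: "K \<in> borel_measurable M" unfolding K_def[abs_def] by measurable
  have K_le: "\<bar>K x\<bar> \<le> 1" for x by (auto simp: K_def indicator_def)
  have intK: "integrable M (\<lambda>x. norm (complex_of_real (K x)) * exp (s * \<bar>V x\<bar>))" if "s \<le> r" for s
  proof (rule Bochner_Integration.integrable_bound[OF int])
    show "AE x in M. norm (norm (complex_of_real (K x)) * exp (s * \<bar>V x\<bar>)) \<le> norm (exp (r * \<bar>V x\<bar>))"
    proof (rule AE_I2)
      fix x
      have "\<bar>K x\<bar> * exp (s * \<bar>V x\<bar>) \<le> 1 * exp (r * \<bar>V x\<bar>)"
        using K_le that by (intro mult_mono) (auto intro: mult_right_mono)
      then show "norm (norm (complex_of_real (K x)) * exp (s * \<bar>V x\<bar>)) \<le> norm (exp (r * \<bar>V x\<bar>))"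
        by (simp add: abs_mult)
    qed
  qed measurable
  have S_eq: "S = {z. Re z < r} \<inter> {z. Re z > - r}" by (auto simp: S_def)
  have "open S" unfolding S_eq by (intro open_Int open_halfspace_Re_lt open_halfspace_Re_gt)
  have "convex S" unfolding S_eq by (intro convex_Int convex_halfspace_Re_lt convex_halfspace_Re_gt)
  have "F holomorphic_on S"
    using exp_integral_has_field_derivative[OF _ _ intK[OF order_refl], of _] \<open>open S\<close>
    unfolding F_def[abs_def] S_def by (auto simp: holomorphic_on_open intro!: exI)
  \<comment> \<open>The expansion of \<open>F\<close> about 0 is available in this disc only; its
    coefficients vanish by \<open>moments\<close>.\<close>
  moreover have "F z = 0" if z: "z \<in> ball 0 r" for z
  proof (cases "z = 0")
    case False
    have int_z: "integrable M (\<lambda>x. norm (complex_of_real (K x)) * exp (norm z * \<bar>V x\<bar>))"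
      using z by (intro intK) auto
    have "(\<integral>x. complex_of_real (K x) * of_real (V x) ^ j \<partial>M) = 0" for j
    proof -
      have iV: "integrable M (\<lambda>x. V x ^ j)"
        using integrable_power_of_exp_abs[OF V r int] .
      have iAV: "integrable M (\<lambda>x. indicator A x * V x ^ j)"
        using integrable_mult_indicator[OF A iV] by simp
      have "(\<integral>x. complex_of_real (K x) * of_real (V x) ^ j \<partial>M) = complex_of_real (\<integral>x. K x * V x ^ j \<partial>M)"
        by (simp flip: integral_complex_of_real)
      also have "(\<integral>x. K x * V x ^ j \<partial>M) = 0"
        using moments[of j] iV iAV by (simp add: K_def left_diff_distrib)
      finally show ?thesis by simp
    qed
    with exp_integral_power_series[OF _ _ int_z]
    have "(\<lambda>j. 0) sums F z" by (simp add: F_def)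
    then show ?thesis using sums_unique sums_zero sums_unique2 by blast
  next
    case True
    then show ?thesis using moments[of 0] by (simp add: F_def K_def emeasure_eq_measure prob_space)
  qed
  moreover have "ball 0 r \<subseteq> S"
    unfolding S_def by (auto intro: le_less_trans[OF abs_Re_le_cmod])
  moreover have "0 islimpt ball (0::complex) r" "0 \<in> S"
    using r by (auto simp: islimpt_ball S_def)
  \<comment> \<open>The identity theorem carries the zeros from the disc to the strip, which
    contains the imaginary axis.\<close>
  ultimately have F0: "F z = 0" if "z \<in> S" for z
    using analytic_continuation[of F S "ball 0 r" 0 z] \<open>open S\<close> convex_connected[OF \<open>convex S\<close>] that
    by blast
  show "(\<integral>x. (indicator A x - prob A) * iexp (u * V x) \<partial>M) = 0" for u
    using F0[of "\<i> * of_real u"] r by (simp add: F_def K_def S_def mult.assoc)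
qed

text \<open>Preimages of measurable sets are intersection-stable generators, so the product rule on
  them passes to the generated sigma-algebras. Any \<open>Z\<close> measurable for \<open>F\<close>
  is allowed, so the innovation becomes independent of arbitrary functions of the past.\<close>

lemma indep_varI_prob_inter:
  assumes "subalgebra M F" "Z \<in> measurable F N" "random_variable borel V"
    and prod: "\<And>A B. A \<in> sets F \<Longrightarrow> B \<in> sets borel \<Longrightarrow>
      prob (A \<inter> (V -` B \<inter> space M)) = prob A * prob (V -` B \<inter> space M)"
  shows "indep_var N Z borel V"
proof -
  have sp: "space F = space M" and F: "sets F \<subseteq> events" using assms(1) by (auto simp: subalgebra_def)
  have stable: "Int_stable {f -` A \<inter> space M | A. A \<in> sets M'}" for f :: "'a \<Rightarrow> 'c" and M' :: "'c measure"
  proof (rule Int_stableI)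
    fix a b assume "a \<in> {f -` A \<inter> space M | A. A \<in> sets M'}" "b \<in> {f -` A \<inter> space M | A. A \<in> sets M'}"
    then obtain A B where "a = f -` A \<inter> space M" "b = f -` B \<inter> space M" "A \<in> sets M'" "B \<in> sets M'" by blast
    then have "a \<inter> b = f -` (A \<inter> B) \<inter> space M" "A \<inter> B \<in> sets M'" by auto
    then show "a \<inter> b \<in> {f -` A \<inter> space M | A. A \<in> sets M'}" by blast
  qed
  have Z: "Z -` A \<inter> space M \<in> sets F" if "A \<in> sets N" for A
    using measurable_sets[OF assms(2) that] sp by simp
  have V: "V -` B \<inter> space M \<in> events" if "B \<in> sets borel" for B
    using measurable_sets[OF assms(3) that] .
  have "indep_set {Z -` A \<inter> space M |A. A \<in> sets N} {V -` A \<inter> space M |A. A \<in> sets borel}"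
    unfolding indep_sets2_eq
  proof (intro conjI ballI subsetI)
    show "a \<in> events" if "a \<in> {Z -` A \<inter> space M |A. A \<in> sets N}" for a
      using that Z F by blast
    show "b \<in> events" if "b \<in> {V -` A \<inter> space M |A. A \<in> sets borel}" for b
      using that V by blast
    show "prob (a \<inter> b) = prob a * prob b"
      if "a \<in> {Z -` A \<inter> space M |A. A \<in> sets N}" "b \<in> {V -` A \<inter> space M |A. A \<in> sets borel}" for a b
    proof -
      from that obtain A B where "a = Z -` A \<inter> space M" "A \<in> sets N" "b = V -` B \<inter> space M" "B \<in> sets borel"
        by blast
      then show ?thesis using prod[OF Z] by simp
    qed
  qed
  from indep_set_sigma_sets[OF this stable stable] show ?thesis
    unfolding indep_var_eq using measurable_from_subalg[OF assms(1,2)] assms(3) by simp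
qed

text \<open>The characters of the variables are replaced one at a time by indicators of events.\<close>

lemma set_integral_gen_sigma_eq_0_of_char:
  fixes K :: "'a \<Rightarrow> complex" and I :: "'i set" and Y :: "'i \<Rightarrow> 'a \<Rightarrow> real"
  assumes K: "integrable M K"
    and Y: "\<And>i. i \<in> I \<Longrightarrow> random_variable borel (Y i)"
    and S_zero: "(\<lambda>_. 0) \<in> S"
    and S_step: "\<And>Z i c. Z \<in> S \<Longrightarrow> i \<in> I \<Longrightarrow> (\<lambda>x. Z x + c * Y i x) \<in> S"
    and S_rv: "\<And>Z. Z \<in> S \<Longrightarrow> random_variable borel Z"
    and S_char: "\<And>Z. Z \<in> S \<Longrightarrow> (\<integral>x. K x * iexp (Z x) \<partial>M) = 0"
    and A: "A \<in> sets (gen_sigma M Y I)"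
  shows "(\<integral>x\<in>A. K x \<partial>M) = 0"
proof -
  have [measurable]: "K \<in> borel_measurable M" using K by auto
  \<comment> \<open>Induction over the coordinates, with \<open>Z\<close> general so that the phase
    \<open>u * Y i x\<close> of the next coordinate can be absorbed into it.\<close>
  have cyl: "(\<integral>x. K x * (\<Prod>i\<in>J. indicator (Y i -` B i) x) * iexp (Z x) \<partial>M) = 0"
    if "finite J" "J \<subseteq> I" "\<And>i. B i \<in> sets borel" "Z \<in> S" for J and B :: "'i \<Rightarrow> real set" and Z
    using that(1,2,4)
  proof (induction J arbitrary: Z)
    case empty
    then show ?case using S_char by simp
  next
    case (insert i J)
    \<comment> \<open>This weight already contains the indicators for \<open>J\<close> and the phase
      \<open>Z\<close>; the induction hypothesis says that its transform against \<open>Y i\<close>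
      vanishes.\<close>
    define K' where "K' x = K x * (\<Prod>i\<in>J. indicator (Y i -` B i) x) * iexp (Z x)" for x
    have [measurable]: "random_variable borel Z" "random_variable borel (Y i)"
      using S_rv Y insert.prems by auto
    have [measurable]: "(\<lambda>x. \<Prod>i\<in>J. indicator (Y i -` B i) x :: complex) \<in> borel_measurable M"
    proof (rule borel_measurable_prod)
      fix j assume "j \<in> J"
      then have [measurable]: "random_variable borel (Y j)" "B j \<in> sets borel"
        using Y[of j] insert.prems that(3)[of j] by auto
      have "(\<lambda>x. indicator (B j) (Y j x) :: complex) \<in> borel_measurable M"
        by measurable
      then show "(\<lambda>x. indicator (Y j -` B j) x :: complex) \<in> borel_measurable M"
        by (simp add: indicator_def)
    qed
    have "integrable M K'"
    proof (rule Bochner_Integration.integrable_bound[OF K])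
      have "norm (\<Prod>i\<in>J. indicator (Y i -` B i) x :: complex) \<le> 1" for x
        by (auto simp: prod_norm[symmetric] indicator_def intro!: prod_le_1)
      then show "AE x in M. norm (K' x) \<le> norm (K x)"
        by (auto simp: K'_def norm_mult mult_left_le)
    qed (simp add: K'_def[abs_def])
    moreover have "(\<integral>x. K' x * iexp (u * Y i x) \<partial>M) = 0" for u
    proof -
      have "(\<integral>x. K x * (\<Prod>i\<in>J. indicator (Y i -` B i) x) * iexp (Z x + u * Y i x) \<partial>M) = 0"
        using insert.prems by (intro insert.IH S_step) auto
      then show ?thesis by (simp add: K'_def exp_add distrib_left mult.assoc)
    qed
    ultimately have "(\<integral>x. K' x * indicator (Y i -` B i) x \<partial>M) = 0"
      by (intro integral_indicator_eq_0_of_char that) auto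
    then show ?case using insert.hyps by (simp add: K'_def mult_ac)
  qed
  define G where "G = {{x \<in> space M. \<forall>i\<in>J. Y i x \<in> B i} | J B.
    finite J \<and> J \<subseteq> I \<and> (\<forall>i. B i \<in> sets borel)}"
  have G_events: "G \<subseteq> events"
  proof (clarsimp simp: G_def)
    fix J and B :: "'i \<Rightarrow> real set" assume "finite J" "J \<subseteq> I" "\<forall>i. B i \<in> sets (borel :: real measure)"
    then show "{x \<in> space M. \<forall>i\<in>J. Y i x \<in> B i} \<in> events"
      using Y by (intro sets.sets_Collect_finite_All) (auto intro: measurable_sets simp: vimage_def Int_def conj_commute)
  qed
  have "Int_stable G"
  proof (rule Int_stableI)
    fix a b assume "a \<in> G" "b \<in> G"
    then obtain J1 J2 and B1 B2 :: "'i \<Rightarrow> real set" where J: "finite J1" "finite J2" "J1 \<subseteq> I" "J2 \<subseteq> I"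
      and B: "\<And>i. B1 i \<in> sets borel" "\<And>i. B2 i \<in> sets borel"
      and ab: "a = {x \<in> space M. \<forall>i\<in>J1. Y i x \<in> B1 i}" "b = {x \<in> space M. \<forall>i\<in>J2. Y i x \<in> B2 i}"
      by (auto simp: G_def)
    \<comment> \<open>\<open>UNIV\<close> means no constraint, so both cylinders can be written over
      the joint index set.\<close>
    define B' where "B' i = (if i \<in> J1 then B1 i else UNIV) \<inter> (if i \<in> J2 then B2 i else UNIV)" for i
    have "a \<inter> b = {x \<in> space M. \<forall>i\<in>J1 \<union> J2. Y i x \<in> B' i}"
      by (auto simp: ab B'_def)
    moreover have "B' i \<in> sets borel" for i using B by (auto simp: B'_def)
    ultimately show "a \<inter> b \<in> G" unfolding G_def mem_Collect_eq using J
      by (intro exI[of _ "J1 \<union> J2"] exI[of _ B'] conjI) auto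
  qed
  have "{Y i -` B \<inter> space M | i B. i \<in> I \<and> B \<in> sets borel} \<subseteq> G"
  proof safe
    fix i B assume "i \<in> I" "B \<in> sets (borel :: real measure)"
    then show "Y i -` B \<inter> space M \<in> G"
      unfolding G_def by (auto intro!: exI[of _ "{i}"] exI[of _ "\<lambda>_. B"])
  qed
  then have "A \<in> sigma_sets (space M) G"
    using A sigma_sets_mono'[of _ G] unfolding sets_gen_sigma by blast
  moreover have sub: "sigma_sets (space M) G \<subseteq> events"
    using G_events by (rule sets.sigma_sets_subset)
  have set_int: "set_integrable M B K" if "B \<in> events" for B
    unfolding set_integrable_def using integrable_mult_indicator[OF that K] .
  \<comment> \<open>The zero function in \<open>S\<close> gives total weight 0, which settles
    complements in the Dynkin induction below.\<close>
  have K0: "(\<integral>x. K x \<partial>M) = 0" using S_char[OF S_zero] by simp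
  have "G \<subseteq> Pow (space M)" using G_events sets.space_closed by blast
  show ?thesis
    using \<open>Int_stable G\<close> \<open>G \<subseteq> Pow (space M)\<close> \<open>A \<in> sigma_sets (space M) G\<close>
  proof (induction rule: sigma_sets_induct_disjoint)
    case (basic a)
    then obtain J and B :: "'i \<Rightarrow> real set" where J: "finite J" "J \<subseteq> I" and B: "\<And>i. B i \<in> sets borel"
      and a: "a = {x \<in> space M. \<forall>i\<in>J. Y i x \<in> B i}"
      by (auto simp: G_def)
    have "(\<integral>x\<in>a. K x \<partial>M) = (\<integral>x. K x * (\<Prod>i\<in>J. indicator (Y i -` B i) x) * iexp 0 \<partial>M)"
      unfolding set_lebesgue_integral_def
    proof (rule Bochner_Integration.integral_cong[OF refl])
      fix x assume "x \<in> space M"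
      then have "(\<Prod>i\<in>J. indicator (Y i -` B i) x) = (indicator a x :: complex)"
        using J by (auto simp: a indicator_def)
      then show "indicator a x *\<^sub>R K x = K x * (\<Prod>i\<in>J. indicator (Y i -` B i) x) * iexp 0"
        by (simp add: indicator_def)
    qed
    also have "\<dots> = 0" by (rule cyl[OF J B S_zero])
    finally show ?case .
  next
    case empty
    show ?case by (simp add: set_lebesgue_integral_def)
  next
    case (compl a)
    have a: "a \<in> events" using subsetD[OF sub compl(1)] .
    have "(\<integral>x\<in>space M - a. K x \<partial>M) = (\<integral>x. K x - indicator a x *\<^sub>R K x \<partial>M)"
      unfolding set_lebesgue_integral_def
      by (intro Bochner_Integration.integral_cong) (auto simp: indicator_def)
    also have "\<dots> = 0"
      using set_int[OF a] K compl(2) K0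
      by (subst Bochner_Integration.integral_diff) (simp_all add: set_integrable_def set_lebesgue_integral_def)
    finally show ?case .
  next
    case (union a)
    have a: "a i \<in> events" for i using union(2) sub by blast
    have "(\<integral>x\<in>(\<Union>i. a i). K x \<partial>M) = (\<Sum>i. \<integral>x\<in>a i. K x \<partial>M)"
    proof (rule lebesgue_integral_countable_add)
      show "a i \<in> events" for i by (rule a)
      show "a i \<inter> a j = {}" if "i \<noteq> j" for i j
        using union(1) that by (auto simp: disjoint_family_on_def)
      show "set_integrable M (\<Union>i. a i) K" using a by (intro set_int sets.countable_UN) auto
    qed
    then show ?case by (simp only: union(3)) simp
  qed
qed

end

section \<open>Centred Gaussian variables\<close>

text \<open>The characteristic function treats all variances \<open>k\<close> alike and includes the
  point mass at 0 as \<open>k = 0\<close>, into which linear combinations of the process may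
  degenerate. Sums of independent variables become products.\<close>

definition (in prob_space) centred_gaussian :: "real \<Rightarrow> ('a \<Rightarrow> real) \<Rightarrow> bool" where
  "centred_gaussian k Z \<longleftrightarrow> random_variable borel Z \<and>
     (\<forall>u. (\<integral>x. iexp (u * Z x) \<partial>M) = of_real (exp (- k * u\<^sup>2 / 2)))"

text \<open>Integration by parts for the normal law, read off from the closed form of the even
  moments; for odd \<open>n\<close> both sides are 0.\<close>

lemma std_normal_moment_rec:
  "(\<integral>x. x ^ (n + 2) \<partial>std_normal_distribution) = real (n + 1) * (\<integral>x. x ^ n \<partial>std_normal_distribution)"
proof (cases "even n")
  case True
  then obtain j where n: "n = 2 * j" by auto
  have "(\<integral>x. x ^ (2 * Suc j) \<partial>std_normal_distribution)
      = real (2 * j + 1) * (\<integral>x. x ^ (2 * j) \<partial>std_normal_distribution)"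
    unfolding std_normal_distribution_even_moments(1)
    by (simp add: divide_simps)
  then show ?thesis by (simp add: n)
next
  case False
  then show ?thesis by (subst (1 2) integral_std_normal_distribution_moment_odd) auto
qed

context prob_space
begin

text \<open>A characteristic function is bounded by 1, which forces \<open>k\<close> to be
  nonnegative. The other claims compare it with that of the point mass at 0 or of the standard
  normal law.\<close>

lemma
  assumes Z: "centred_gaussian k Z"
  shows centred_gaussian_nonneg: "0 \<le> k"
    and centred_gaussian_AE_zero: "k = 0 \<Longrightarrow> AE x in M. Z x = 0"
    and centred_gaussian_distr: "0 < k \<Longrightarrow> distr M borel (\<lambda>x. Z x / sqrt k) = std_normal_distribution"
    and centred_gaussian_distributed: "0 < k \<Longrightarrow> distributed M lborel Z (normal_density 0 (sqrt k))"
proof -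
  have [measurable]: "random_variable borel Z"
    and char: "(\<integral>x. iexp (u * Z x) \<partial>M) = of_real (exp (- k * u\<^sup>2 / 2))" for u
    using Z by (auto simp: centred_gaussian_def)
  have char_distr: "char (distr M borel (\<lambda>x. Z x * c)) u = of_real (exp (- k * (c * u)\<^sup>2 / 2))" for c u
    using char[of "c * u"] unfolding char_def by (subst integral_distr) (auto simp: mult_ac)
  have "cmod (char (distr M borel (\<lambda>x. Z x * 1)) 1) \<le> 1"
    by (intro real_distribution.cmod_char_le_1 real_distribution_distr) measurable
  then show k: "0 \<le> k" unfolding char_distr by (simp add: norm_exp_eq_Re)
  show "AE x in M. Z x = 0" if "k = 0"
  proof -
    interpret R: prob_space "return borel (0::real)" by (rule prob_space_return) simp
    have "char (return borel 0) u = 1" for u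
      unfolding char_def by (subst integral_return) auto
    then have "char (distr M borel (\<lambda>x. Z x * 1)) = char (return borel 0)"
      using that unfolding fun_eq_iff char_distr by simp
    then have "distr M borel (\<lambda>x. Z x * 1) = return borel 0"
      by (intro Levy_uniqueness real_distribution_distr)
        (auto simp: real_distribution_def real_distribution_axioms_def R.prob_space_axioms)
    moreover have "AE y in return borel (0::real). y = 0"
      by (subst AE_return) auto
    ultimately have "AE y in distr M borel (\<lambda>x. Z x * 1). y = 0" by (simp only:)
    then show ?thesis by (subst (asm) AE_distr_iff) auto
  qed
  show distr: "distr M borel (\<lambda>x. Z x / sqrt k) = std_normal_distribution" if "0 < k"
  proof -
    have "char (distr M borel (\<lambda>x. Z x * (1 / sqrt k))) = char std_normal_distribution"
      unfolding fun_eq_iff char_distr char_std_normal_distribution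
      using that by (simp add: power_divide)
    then have "distr M borel (\<lambda>x. Z x * (1 / sqrt k)) = std_normal_distribution"
      by (intro Levy_uniqueness real_distribution_distr real_dist_normal_dist) measurable
    then show ?thesis by simp
  qed
  show "distributed M lborel Z (normal_density 0 (sqrt k))" if "0 < k"
  proof -
    have "distr M lborel (\<lambda>x. Z x / sqrt k) = distr M borel (\<lambda>x. Z x / sqrt k)"
      by (rule distr_cong) auto
    then show ?thesis
      using that distr by (subst normal_standard_normal_convert) (auto simp: distributed_def)
  qed
qed

text \<open>For positive \<open>k\<close> these are standard normal moments rescaled by
  \<open>sqrt k\<close>. For \<open>k = 0\<close>, where this rescaling breaks down, the variable is
  almost surely 0.\<close>

lemma
  assumes Z: "centred_gaussian k Z"
  shows centred_gaussian_integrable_power: "integrable M (\<lambda>x. Z x ^ n)"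
    and centred_gaussian_moment_1: "(\<integral>x. Z x \<partial>M) = 0"
    and centred_gaussian_moment_rec: "(\<integral>x. Z x ^ (n + 2) \<partial>M) = k * real (n + 1) * (\<integral>x. Z x ^ n \<partial>M)"
proof -
  have [measurable]: "random_variable borel Z" using Z by (auto simp: centred_gaussian_def)
  have *: "integrable M (\<lambda>x. Z x ^ n) \<and> (\<integral>x. Z x \<partial>M) = 0 \<and>
      (\<integral>x. Z x ^ (n + 2) \<partial>M) = k * real (n + 1) * (\<integral>x. Z x ^ n \<partial>M)"
  proof (cases "k = 0")
    case True
    with Z have ae: "AE x in M. Z x = 0" by (rule centred_gaussian_AE_zero)
    have "integrable M (\<lambda>x. Z x ^ n) \<longleftrightarrow> integrable M (\<lambda>x. 0 ^ n :: real)"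
      using ae by (intro integrable_cong_AE) auto
    moreover have "(\<integral>x. Z x ^ m \<partial>M) = (\<integral>x. 0 ^ m \<partial>M)" for m
      using ae by (intro integral_cong_AE) auto
    from this[of 1] this[of "n + 2"]
    have "(\<integral>x. Z x \<partial>M) = 0" "(\<integral>x. Z x ^ (n + 2) \<partial>M) = 0" by auto
    ultimately show ?thesis using True by simp
  next
    case False
    with centred_gaussian_nonneg[OF Z] have k: "k > 0" by simp
    define W where "W x = Z x / sqrt k" for x
    have [measurable]: "random_variable borel W" unfolding W_def[abs_def] by measurable
    have distr: "distr M borel W = std_normal_distribution"
      using centred_gaussian_distr[OF Z k] by (simp add: W_def[abs_def])
    have int: "integrable M (\<lambda>x. W x ^ m)" for m
      using integrable_std_normal_distribution_moment[of m]
      by (subst (asm) distr[symmetric], subst (asm) integrable_distr_eq) auto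
    have mom: "(\<integral>x. W x ^ m \<partial>M) = (\<integral>x. x ^ m \<partial>std_normal_distribution)" for m
      by (subst distr[symmetric], subst integral_distr) auto
    have ZW: "Z x = sqrt k * W x" for x using k by (simp add: W_def)
    have "(\<integral>x. W x \<partial>M) = 0"
      using mom[of 1] integral_std_normal_distribution_moment_odd[of 1] by simp
    moreover have "integrable M (\<lambda>x. Z x ^ n)" using int by (simp add: ZW power_mult_distrib)
    moreover have "(\<integral>x. Z x ^ (n + 2) \<partial>M) = k * real (n + 1) * (\<integral>x. Z x ^ n \<partial>M)"
    proof -
      have "(\<integral>x. Z x ^ m \<partial>M) = sqrt k ^ m * (\<integral>x. x ^ m \<partial>std_normal_distribution)" for m
        unfolding ZW power_mult_distrib mom[symmetric] by (rule integral_mult_right_zero)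
      moreover have "sqrt k ^ (n + 2) = k * sqrt k ^ n" using k by (simp add: power_add)
      ultimately show ?thesis by (simp only: std_normal_moment_rec mult_ac)
    qed
    ultimately show ?thesis by (simp add: ZW)
  qed
  from * show "integrable M (\<lambda>x. Z x ^ n)" "(\<integral>x. Z x \<partial>M) = 0"
    "(\<integral>x. Z x ^ (n + 2) \<partial>M) = k * real (n + 1) * (\<integral>x. Z x ^ n \<partial>M)" by auto
qed

lemma centred_gaussian_scale:
  assumes "centred_gaussian k Z"
  shows "centred_gaussian (c\<^sup>2 * k) (\<lambda>x. c * Z x)"
  unfolding centred_gaussian_def
proof (intro conjI allI)
  show "random_variable borel (\<lambda>x. c * Z x)" using assms by (auto simp: centred_gaussian_def)
  fix u
  have "(\<integral>x. iexp ((u * c) * Z x) \<partial>M) = of_real (exp (- k * (u * c)\<^sup>2 / 2))"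
    using assms unfolding centred_gaussian_def by blast
  then show "(\<integral>x. iexp (u * (c * Z x)) \<partial>M) = of_real (exp (- (c\<^sup>2 * k) * u\<^sup>2 / 2))"
    by (simp add: mult_ac power_mult_distrib)
qed

lemma iexp_indep_var:
  assumes "indep_var borel V borel W"
  shows "(\<integral>x. iexp (V x + W x) \<partial>M) = (\<integral>x. iexp (V x) \<partial>M) * (\<integral>x. iexp (W x) \<partial>M)"
proof -
  have "(\<integral>x. iexp (V x) * iexp (W x) \<partial>M) = (\<integral>x. iexp (V x) \<partial>M) * (\<integral>x. iexp (W x) \<partial>M)"
    using indep_var_rv1[OF assms] indep_var_rv2[OF assms]
    by (intro indep_var_lebesgue_integral indep_var_compose[unfolded comp_def, OF assms])
       (auto intro!: integrable_iexp)
  then show ?thesis by (simp add: exp_add distrib_left)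
qed

lemma centred_gaussian_add:
  assumes Z: "centred_gaussian k Z" "centred_gaussian l W" and ind: "indep_var borel Z borel W"
  shows "centred_gaussian (k + l) (\<lambda>x. Z x + W x)"
  unfolding centred_gaussian_def
proof (intro conjI allI)
  show "random_variable borel (\<lambda>x. Z x + W x)" using Z by (auto simp: centred_gaussian_def)
  fix u
  have "indep_var borel (\<lambda>x. u * Z x) borel (\<lambda>x. u * W x)"
    by (intro indep_var_compose[unfolded comp_def, OF ind]) auto
  from iexp_indep_var[OF this]
  have "(\<integral>x. iexp (u * (Z x + W x)) \<partial>M) = of_real (exp (- k * u\<^sup>2 / 2) * exp (- l * u\<^sup>2 / 2))"
    using Z unfolding centred_gaussian_def distrib_left by (simp only: of_real_mult)
  also have "exp (- k * u\<^sup>2 / 2) * exp (- l * u\<^sup>2 / 2) = exp (- (k + l) * u\<^sup>2 / 2)"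
    unfolding exp_add[symmetric] by (simp add: field_simps)
  finally show "(\<integral>x. iexp (u * (Z x + W x)) \<partial>M) = of_real (exp (- (k + l) * u\<^sup>2 / 2))" .
qed

text \<open>The moment recursion at \<open>n = 0\<close>. It identifies the variance where a
  construction only yields some \<open>k\<close>.\<close>

lemma centred_gaussian_unique_variance:
  assumes "centred_gaussian k Z"
  shows "(\<integral>x. (Z x)\<^sup>2 \<partial>M) = k"
  using centred_gaussian_moment_rec[OF assms, of 0] by (simp add: numeral_2_eq_2 prob_space)

end

section \<open>Autoregression with independent innovations\<close>

text \<open>The complement is the union of all open null sets, and Lindelof's theorem reduces this
  union to a countable one.\<close>

lemma emeasure_compl_measure_support:
  fixes \<mu> :: "'a::second_countable_topology measure"
  assumes sets: "sets \<mu> = sets borel"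
  shows "closed (measure_support \<mu>)" "emeasure \<mu> (- measure_support \<mu>) = 0"
proof -
  define \<U> where "\<U> = {U. open U \<and> emeasure \<mu> U = 0}"
  have compl: "- measure_support \<mu> = \<Union>\<U>"
    by (auto simp: measure_support_def \<U>_def not_less zero_less_iff_neq_zero)
  show "closed (measure_support \<mu>)"
    unfolding closed_def compl by (auto simp: \<U>_def)
  obtain \<V> where \<V>: "\<V> \<subseteq> \<U>" "countable \<V>" "\<Union>\<V> = \<Union>\<U>"
    using Lindelof[of \<U>] by (auto simp: \<U>_def)
  have "V \<in> null_sets \<mu>" if "V \<in> \<V>" for V
    using that \<V>(1) sets by (auto simp: \<U>_def null_sets_def)
  with \<V>(2) have "(\<Union>V\<in>\<V>. V) \<in> null_sets \<mu>" by (rule null_sets_UN')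
  then show "emeasure \<mu> (- measure_support \<mu>) = 0"
    using \<V>(3) compl by auto
qed

text \<open>Deleting the finitely many other points leaves an open neighbourhood of
  \<open>a\<close>, and whatever it contains besides \<open>a\<close> lies off the support.\<close>

lemma emeasure_singleton_finite_support:
  fixes \<mu> :: "'a::{second_countable_topology, t1_space} measure"
  assumes sets: "sets \<mu> = sets borel" and "finite (measure_support \<mu>)" "a \<in> measure_support \<mu>"
  shows "emeasure \<mu> {a} > 0"
proof -
  let ?S = "measure_support \<mu>"
  let ?U = "- (?S - {a})"
  have "open ?U" using assms by (intro open_Compl finite_imp_closed) auto
  then have "0 < emeasure \<mu> ?U" using assms by (auto simp: measure_support_def)
  also have "?U = {a} \<union> - ?S" using assms by auto
  also have "emeasure \<mu> ({a} \<union> - ?S) \<le> emeasure \<mu> {a} + emeasure \<mu> (- ?S)"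
    using emeasure_compl_measure_support(1)[OF sets]
    by (intro emeasure_subadditive) (auto simp: sets)
  finally show ?thesis using emeasure_compl_measure_support(2)[OF sets] by simp
qed

context prob_space
begin

text \<open>For nonnegative variables the product formula holds in \<open>ennreal\<close> without
  integrability, and the expectation of \<open>V\<close> is not 0. It gives the innovation
  exponential moments on the whole interval below \<open>R\<close>, where the estimate by squares
  would shrink the interval.\<close>

lemma indep_var_integrable_factor:
  fixes V W :: "'a \<Rightarrow> real"
  assumes ind: "indep_var borel V borel W" and pos: "\<And>x. V x > 0" "\<And>x. W x > 0"
    and int: "integrable M (\<lambda>x. V x * W x)"
  shows "integrable M W"
proof -
  have [measurable]: "random_variable borel V" "random_variable borel W"
    using ind by (auto dest: indep_var_rv1 indep_var_rv2)
  have borel: "(\<lambda>_. borel) = case_bool borel (borel :: real measure)"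
    by (rule ext) (simp split: bool.split)
  have eborel: "(\<lambda>_. borel) = case_bool borel (borel :: ennreal measure)"
    by (rule ext) (simp split: bool.split)
  have "indep_var borel (\<lambda>x. ennreal (V x)) borel (\<lambda>x. ennreal (W x))"
    by (rule indep_var_compose[unfolded comp_def, OF ind]) auto
  then have "indep_vars (\<lambda>_. borel) (case_bool (\<lambda>x. ennreal (V x)) (\<lambda>x. ennreal (W x))) UNIV"
    unfolding indep_var_def eborel .
  from indep_vars_nn_integral[OF _ this]
  have "(\<integral>\<^sup>+x. ennreal (V x) * ennreal (W x) \<partial>M) = (\<integral>\<^sup>+x. V x \<partial>M) * (\<integral>\<^sup>+x. W x \<partial>M)"
    by (simp add: UNIV_bool mult.commute)
  moreover have "(\<integral>\<^sup>+x. ennreal (V x) * ennreal (W x) \<partial>M) < \<infinity>"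
    using int pos by (simp add: integrable_iff_bounded abs_mult less_imp_le flip: ennreal_mult)
  moreover have "(\<integral>\<^sup>+x. V x \<partial>M) \<noteq> 0"
  proof
    assume "(\<integral>\<^sup>+x. V x \<partial>M) = 0"
    then have "AE x in M. ennreal (V x) = 0" by (subst (asm) nn_integral_0_iff_AE) auto
    then have "AE x in M. False"
      by eventually_elim (use pos(1) in \<open>auto simp: ennreal_eq_0_iff dest: leD\<close>)
    then show False by simp
  qed
  ultimately have "(\<integral>\<^sup>+x. W x \<partial>M) < \<infinity>"
    by (auto simp: ennreal_mult_less_top top_unique less_top[symmetric])
  then show ?thesis using pos by (intro integrableI_bounded) (auto simp: less_imp_le)
qed

end

lemma integrable_mult_of_square:
  fixes f g :: "'a \<Rightarrow> real"
  assumes [measurable]: "f \<in> borel_measurable M" "g \<in> borel_measurable M"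
    and "integrable M (\<lambda>x. (f x)\<^sup>2)" "integrable M (\<lambda>x. (g x)\<^sup>2)"
  shows "integrable M (\<lambda>x. f x * g x)"
proof (rule Bochner_Integration.integrable_bound)
  show "integrable M (\<lambda>x. (f x)\<^sup>2 + (g x)\<^sup>2)" using assms by auto
  have "\<bar>a * b\<bar> \<le> a\<^sup>2 + b\<^sup>2" for a b :: real
  proof -
    have "0 \<le> \<bar>a\<bar> * \<bar>b\<bar>" by simp
    then show ?thesis
      using sum_squares_bound[of "\<bar>a\<bar>" "\<bar>b\<bar>"] unfolding abs_mult power2_abs by linarith
  qed
  then show "AE x in M. norm (f x * g x) \<le> norm ((f x)\<^sup>2 + (g x)\<^sup>2)" by auto
qed measurable

text \<open>What is known before the innovations are proved independent. Both that independence and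
  the reversed regression are derived at this level.\<close>

locale exp_moment_process = prob_space M for M :: "'a measure" +
  fixes X :: "real \<Rightarrow> 'a \<Rightarrow> real" and R :: real
  assumes rv [measurable]: "random_variable borel (X t)"
    and law: "distr M borel (X t) = distr M borel (X 0)"
    and R_pos: "R > 0"
    and exp_integrable_0: "\<bar>y\<bar> < R \<Longrightarrow> integrable M (\<lambda>x. exp (y * X 0 x))"
    and mean_0: "(\<integral>x. X 0 x \<partial>M) = 0"
begin

abbreviation innovation :: "real \<Rightarrow> real \<Rightarrow> 'a \<Rightarrow> real" where
  "innovation s t \<equiv> \<lambda>x. X t x - exp (s - t) * X s x"

lemma integral_law:
  fixes g :: "real \<Rightarrow> 'b::{banach, second_countable_topology}"
  assumes [measurable]: "g \<in> borel_measurable borel"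
  shows "(\<integral>x. g (X t x) \<partial>M) = (\<integral>x. g (X 0 x) \<partial>M)"
  using integral_distr[of "X t" M borel g] integral_distr[of "X 0" M borel g] law[of t] by simp

lemma integrable_law:
  fixes g :: "real \<Rightarrow> 'b::{banach, second_countable_topology}"
  assumes [measurable]: "g \<in> borel_measurable borel"
  shows "integrable M (\<lambda>x. g (X t x)) \<longleftrightarrow> integrable M (\<lambda>x. g (X 0 x))"
  using integrable_distr_eq[of "X t" M borel g] integrable_distr_eq[of "X 0" M borel g] law[of t] by simp

lemma prob_law:
  assumes "B \<in> sets borel"
  shows "prob (X t -` B \<inter> space M) = prob (X 0 -` B \<inter> space M)"
  using measure_distr[of "X t" M borel B] measure_distr[of "X 0" M borel B] law[of t] assms by simp

lemma exp_integrable: "\<bar>y\<bar> < R \<Longrightarrow> integrable M (\<lambda>x. exp (y * X t x))"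
  using exp_integrable_0[of y] by (subst integrable_law) auto

lemma exp_abs_integrable:
  assumes "0 \<le> r" "r < R"
  shows "integrable M (\<lambda>x. exp (r * \<bar>X t x\<bar>))"
proof (rule Bochner_Integration.integrable_bound)
  show "integrable M (\<lambda>x. exp (r * X t x) + exp (- r * X t x))"
    using assms by (intro Bochner_Integration.integrable_add exp_integrable) auto
  have "exp (r * \<bar>v\<bar>) \<le> exp (r * v) + exp (- r * v)" for v
    by (cases "v \<ge> 0") auto
  then show "AE x in M. norm (exp (r * \<bar>X t x\<bar>)) \<le> norm (exp (r * X t x) + exp (- r * X t x))"
    by (auto intro!: AE_I2 order_trans[OF _ abs_ge_self])
qed measurable

lemma power_integrable: "integrable M (\<lambda>x. X t x ^ n)"
  using R_pos by (intro integrable_power_of_exp_abs[of _ _ "R / 2"] exp_abs_integrable) auto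

lemma X_integrable: "integrable M (X t)"
  using power_integrable[of t 1] by simp

lemma mean: "(\<integral>x. X t x \<partial>M) = 0"
  using integral_law[of "\<lambda>x. x" t] mean_0 by simp

lemma innovation_mean: "(\<integral>x. innovation s t x \<partial>M) = 0"
  by (subst Bochner_Integration.integral_diff) (auto simp: X_integrable mean)

lemma subalgebra_past: "subalgebra M (gen_sigma M X I)"
  by (intro subalgebra_gen_sigma rv)

lemma measurable_past: "r \<le> s \<Longrightarrow> X r \<in> borel_measurable (gen_sigma M X {..s})"
  by (intro measurable_gen_sigma) auto

text \<open>\<open>integrable_mult_of_square\<close> doubles the exponent \<open>R / 4\<close> to
  \<open>R / 2\<close>, still below \<open>R\<close>. Any positive radius suffices for the moment
  argument.\<close>

lemma innovation_exp_abs_integrable: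
  assumes "s < t"
  shows "integrable M (\<lambda>x. exp (R / 4 * \<bar>innovation s t x\<bar>))"
proof (rule Bochner_Integration.integrable_bound)
  show "integrable M (\<lambda>x. exp (R / 4 * \<bar>X t x\<bar>) * exp (R / 4 * \<bar>X s x\<bar>))"
  proof (rule integrable_mult_of_square)
    have "(exp (R / 4 * \<bar>v\<bar>))\<^sup>2 = exp (R / 2 * \<bar>v\<bar>)" for v
      by (simp add: power2_eq_square flip: exp_add)
    then show "integrable M (\<lambda>x. (exp (R / 4 * \<bar>X t x\<bar>))\<^sup>2)" "integrable M (\<lambda>x. (exp (R / 4 * \<bar>X s x\<bar>))\<^sup>2)"
      using R_pos exp_abs_integrable[of "R / 2"] by auto
  qed measurable
  show "AE x in M. norm (exp (R / 4 * \<bar>innovation s t x\<bar>)) \<le>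
      norm (exp (R / 4 * \<bar>X t x\<bar>) * exp (R / 4 * \<bar>X s x\<bar>))"
  proof (rule AE_I2)
    fix x
    have "exp (s - t) * \<bar>X s x\<bar> \<le> 1 * \<bar>X s x\<bar>" using assms by (intro mult_right_mono) auto
    then have "\<bar>innovation s t x\<bar> \<le> \<bar>X t x\<bar> + \<bar>X s x\<bar>"
      using abs_triangle_ineq4[of "X t x" "exp (s - t) * X s x"] by (simp add: abs_mult)
    then have "R / 4 * \<bar>innovation s t x\<bar> \<le> R / 4 * (\<bar>X t x\<bar> + \<bar>X s x\<bar>)"
      using R_pos by (intro mult_left_mono) auto
    then show "norm (exp (R / 4 * \<bar>innovation s t x\<bar>)) \<le>
        norm (exp (R / 4 * \<bar>X t x\<bar>) * exp (R / 4 * \<bar>X s x\<bar>))"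
      by (simp add: distrib_left flip: exp_add)
  qed
qed measurable

end

locale ar_process = exp_moment_process +
  assumes innovation_indep: "s < t \<Longrightarrow> A \<in> sets (gen_sigma M X {..s}) \<Longrightarrow> B \<in> sets borel \<Longrightarrow>
      prob (A \<inter> (innovation s t -` B \<inter> space M)) = prob A * prob (innovation s t -` B \<inter> space M)"
begin

lemma indep_var_innovation:
  assumes "s < t" "Z \<in> measurable (gen_sigma M X {..s}) N"
  shows "indep_var N Z borel (innovation s t)"
  by (rule indep_varI_prob_inter[OF subalgebra_past assms(2) _ innovation_indep[OF assms(1)]]) auto

text \<open>\<open>X t\<close> is the sum of the independent terms \<open>exp (s - t) * X s\<close>
  and \<open>innovation s t\<close>, and the exponential turns the sum into a product.\<close>

lemma
  assumes st: "s < t" and y: "\<bar>y\<bar> < R"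
  shows innovation_exp_integrable: "integrable M (\<lambda>x. exp (y * innovation s t x))"
    and mgf_innovation: "(\<integral>x. exp (y * X t x) \<partial>M) =
      (\<integral>x. exp (y * exp (s - t) * X s x) \<partial>M) * (\<integral>x. exp (y * innovation s t x) \<partial>M)"
proof -
  have "indep_var borel (X s) borel (innovation s t)"
    by (intro indep_var_innovation st measurable_past order_refl)
  from indep_var_compose[unfolded comp_def, OF this, of "\<lambda>v. exp (y * exp (s - t) * v)" borel "\<lambda>v. exp (y * v)" borel]
  have ind: "indep_var borel (\<lambda>x. exp (y * exp (s - t) * X s x)) borel (\<lambda>x. exp (y * innovation s t x))"
    by simp
  have eq: "exp (y * exp (s - t) * X s x) * exp (y * innovation s t x) = exp (y * X t x)" for x
    by (simp add: algebra_simps flip: exp_add)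
  show int: "integrable M (\<lambda>x. exp (y * innovation s t x))"
    by (rule indep_var_integrable_factor[OF ind]) (auto simp: eq exp_integrable[OF y])
  have "\<bar>y\<bar> * exp (s - t) \<le> \<bar>y\<bar> * 1" using st by (intro mult_left_mono) auto
  then have "integrable M (\<lambda>x. exp (y * exp (s - t) * X s x))"
    using y by (intro exp_integrable) (simp add: abs_mult)
  from indep_var_lebesgue_integral[OF ind this int]
  show "(\<integral>x. exp (y * X t x) \<partial>M) =
      (\<integral>x. exp (y * exp (s - t) * X s x) \<partial>M) * (\<integral>x. exp (y * innovation s t x) \<partial>M)"
    by (simp only: eq)
qed

text \<open>Let \<open>a\<close> be the largest atom and U the innovation from time 0 to 1. On the
  event X_0 = a, U cannot exceed \<open>c = a - exp (- 1) * a\<close>, so by independence it almost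
  never does. Then X_1 = a forces X_0 = a and U = c; comparing probabilities gives U = c almost
  surely. As U is centred, c = 0 and a = 0, so X_0 is nonpositive with mean 0.\<close>

lemma AE_X_zero_if_finite_support:
  assumes fin: "finite (measure_support (distr M borel (X 0)))"
  shows "AE x in M. X 0 x = 0"
proof -
  let ?\<mu> = "distr M borel (X 0)"
  let ?S = "measure_support ?\<mu>"
  interpret \<mu>: prob_space ?\<mu> by (rule prob_space_distr) measurable
  have sets: "sets ?\<mu> = sets borel" by simp
  have "?S \<noteq> {}"
  proof
    assume "?S = {}"
    then show False using emeasure_compl_measure_support(2)[OF sets] \<mu>.emeasure_space_1 by simp
  qed
  define a where "a = Max ?S"
  have "a \<in> ?S" unfolding a_def using fin \<open>?S \<noteq> {}\<close> by (rule Max_in)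
  have "emeasure ?\<mu> {a<..} \<le> emeasure ?\<mu> (- ?S)"
    using fin emeasure_compl_measure_support(1)[OF sets]
    by (intro emeasure_mono) (auto simp: a_def leD)
  then have "emeasure ?\<mu> {a<..} = 0"
    using emeasure_compl_measure_support(2)[OF sets] by simp
  then have "prob (X 0 -` {a<..} \<inter> space M) = 0"
    by (simp add: emeasure_distr measure_def)
  then have gt: "prob (X t -` {a<..} \<inter> space M) = 0" for t by (subst prob_law) auto
  have le: "AE x in M. X t x \<le> a" for t
  proof -
    have "X t -` {a<..} \<inter> space M \<in> null_sets M"
      using gt[of t] by (auto simp: null_sets_def emeasure_eq_measure)
    then show ?thesis by (rule AE_I') auto
  qed
  define q where "q = prob (X 0 -` {a} \<inter> space M)"
  have "q > 0"
    using emeasure_singleton_finite_support[OF sets fin \<open>a \<in> ?S\<close>]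
    by (simp add: emeasure_distr q_def emeasure_eq_measure)
  have q: "prob (X t -` {a} \<inter> space M) = q" for t unfolding q_def by (rule prob_law) simp
  let ?U = "innovation 0 1"
  define c where "c = a - exp (- 1) * a"
  have ev: "X 0 -` {a} \<inter> space M \<in> sets (gen_sigma M X {..0})"
    using measurable_sets[OF measurable_past[of 0 0], of "{a}"] by simp
  have prod: "prob ((X 0 -` {a} \<inter> space M) \<inter> (?U -` B \<inter> space M)) = q * prob (?U -` B \<inter> space M)"
    if "B \<in> sets borel" for B
    using innovation_indep[OF _ ev that, of 1] q[of 0] by simp
  have "prob ((X 0 -` {a} \<inter> space M) \<inter> (?U -` {c<..} \<inter> space M)) \<le> prob (X 1 -` {a<..} \<inter> space M)"
    by (intro finite_measure_mono) (auto simp: c_def)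
  with gt[of 1] prod[of "{c<..}"] have "q * prob (?U -` {c<..} \<inter> space M) \<le> 0" by simp
  with \<open>q > 0\<close> have "prob (?U -` {c<..} \<inter> space M) = 0"
    by (simp add: mult_le_0_iff measure_le_0_iff)
  then have "?U -` {c<..} \<inter> space M \<in> null_sets M"
    by (auto simp: null_sets_def emeasure_eq_measure)
  then have U_le: "AE x in M. ?U x \<le> c" by (rule AE_I') auto
  \<comment> \<open>Both summands of X_1 are at their almost sure maxima when X_1 = a; independence
    then yields q = q * prob (U = c).\<close>
  have "q = prob (X 1 -` {a} \<inter> space M)" using q by simp
  also have "\<dots> = prob ((X 0 -` {a} \<inter> space M) \<inter> (?U -` {c} \<inter> space M))"
  proof (rule finite_measure_eq_AE)
    show "AE x in M. x \<in> X 1 -` {a} \<inter> space M \<longleftrightarrow> x \<in> (X 0 -` {a} \<inter> space M) \<inter> (?U -` {c} \<inter> space M)"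
      using U_le le[of 0] AE_space
    proof eventually_elim
      case (elim x)
      have "X 1 x = exp (- 1) * X 0 x + ?U x" by simp
      moreover have "exp (- 1) * X 0 x \<le> exp (- 1) * a" using elim by simp
      moreover have "exp (- 1) * X 0 x = exp (- 1) * a \<longleftrightarrow> X 0 x = a" by simp
      ultimately show ?case using elim unfolding c_def by auto
    qed
  qed measurable
  also have "\<dots> = q * prob (?U -` {c} \<inter> space M)" by (rule prod) simp
  finally have "prob (?U -` {c} \<inter> space M) = 1" using \<open>q > 0\<close> by simp
  then have "AE x in M. x \<in> ?U -` {c} \<inter> space M" by (subst (asm) prob_eq_1) auto
  then have "AE x in M. ?U x = c" by eventually_elim auto
  then have "(\<integral>x. ?U x \<partial>M) = (\<integral>x. c \<partial>M)" by (intro integral_cong_AE) auto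
  then have "c = 0" using innovation_mean[where s = 0 and t = 1] by (simp add: prob_space)
  then have "(1 - exp (- 1)) * a = 0" unfolding c_def by (simp only: left_diff_distrib mult_1)
  moreover have "exp (- 1) \<noteq> (1 :: real)" unfolding exp_eq_one_iff by simp
  ultimately have "a = 0" by simp
  have "AE x in M. - X 0 x = 0"
    using integral_nonneg_eq_0_iff_AE[of M "\<lambda>x. - X 0 x"] le[of 0] X_integrable[of 0] mean[of 0]
    unfolding \<open>a = 0\<close> by simp
  then show ?thesis by simp
qed

end

section \<open>The Lamperti transform: independent increments and generating functions\<close>

context ar_process
begin

lemma lamperti_pos: "\<tau> > 0 \<Longrightarrow> lamperti 1 X \<tau> = (\<lambda>x. sqrt \<tau> * X (ln \<tau> / 2) x)"
  by (simp add: lamperti_def fun_eq_iff)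

lemma exp_half_ln_diff:
  assumes "0 < \<sigma>" "0 < \<tau>"
  shows "exp (ln \<sigma> / 2 - ln \<tau> / 2) = sqrt \<sigma> / sqrt \<tau>"
  unfolding ln_sqrt[OF less_imp_le[OF assms(1)], symmetric] ln_sqrt[OF less_imp_le[OF assms(2)], symmetric] exp_diff
  using assms by simp

text \<open>Under the time change the autoregression factor is
  \<open>sqrt \<sigma> / sqrt \<tau>\<close>, so scaling by \<open>sqrt \<tau>\<close> turns the
  subtracted term into exactly the value at \<sigma>.\<close>

lemma lamperti_increment:
  assumes "0 < \<sigma>" "0 < \<tau>"
  shows "lamperti 1 X \<tau> x - lamperti 1 X \<sigma> x = sqrt \<tau> * innovation (ln \<sigma> / 2) (ln \<tau> / 2) x"
  using assms(2) unfolding lamperti_pos[OF assms(1)] lamperti_pos[OF assms(2)] exp_half_ln_diff[OF assms]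
  by (simp add: right_diff_distrib)

lemma lamperti_measurable_past:
  assumes "ln \<tau> / 2 \<le> s"
  shows "lamperti 1 X \<tau> \<in> borel_measurable (gen_sigma M X {..s})"
proof (cases "\<tau> > 0")
  case True
  with measurable_past[OF assms] show ?thesis by (simp add: lamperti_pos)
next
  case False
  then have "lamperti 1 X \<tau> = (\<lambda>_. 0)" by (simp add: lamperti_def fun_eq_iff)
  then show ?thesis by simp
qed

lemma lamperti_measurable [measurable]: "random_variable borel (lamperti 1 X \<tau>)"
  using measurable_from_subalg[OF subalgebra_past lamperti_measurable_past[OF order_refl]] .

lemma independent_increments_lamperti: "independent_increments_on M {0..} (lamperti 1 X)"
  unfolding independent_increments_on_def
proof safe
  fix n and t :: "nat \<Rightarrow> real"
  assume nonneg: "\<forall>i\<le>n. t i \<in> {0..}" and incr: "\<forall>i<n. t i < t (Suc i)"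
  define D where "D i x = lamperti 1 X (t (Suc i)) x - lamperti 1 X (t i) x" for i x
  have [measurable]: "random_variable borel (D i)" for i
    unfolding D_def[abs_def] by measurable
  have mono: "t i \<le> t j" if "i \<le> j" "j \<le> n" for i j
    using that(1,2)
  proof (induction j rule: dec_induct)
    case (step m)
    then show ?case using incr by (meson Suc_le_lessD less_imp_le_nat less_imp_le order_trans)
  qed simp
  have prod: "prob {x\<in>space M. \<forall>i<m. D i x \<in> B i} = (\<Prod>i<m. prob (D i -` B i \<inter> space M))"
    if m: "m \<le> n" and B: "\<And>i. B i \<in> sets borel" for m and B :: "nat \<Rightarrow> real set"
    using m
  proof (induction m)
    case 0
    then show ?case by (simp add: prob_space)
  next
    case (Suc m)
    let ?A = "{x\<in>space M. \<forall>i<m. D i x \<in> B i}"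
    have split: "{x\<in>space M. \<forall>i<Suc m. D i x \<in> B i} = ?A \<inter> (D m -` B m \<inter> space M)"
      by (auto simp: less_Suc_eq)
    show ?case
    \<comment> \<open>The first increment may start at time 0, which has no logarithmic time, but a
      single factor requires no independence. Later increments start at positive times.\<close>
    proof (cases "m = 0")
      case True
      have "{x\<in>space M. D 0 x \<in> B 0} = D 0 -` B 0 \<inter> space M" by auto
      with True show ?thesis by simp
    next
      case False
      have "0 \<le> t (m - 1)" "t (m - 1) < t m" "t m < t (Suc m)"
        using False Suc.prems nonneg incr[rule_format, of "m - 1"] incr[rule_format, of m] by auto
      then have pos: "0 < t m" "0 < t (Suc m)" by auto
      let ?s = "ln (t m) / 2" and ?t = "ln (t (Suc m)) / 2"
      have "?s < ?t" using pos \<open>t m < t (Suc m)\<close> by simp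
      have meas: "D i \<in> borel_measurable (gen_sigma M X {..?s})" if "i < m" for i
      proof -
        have "lamperti 1 X (t j) \<in> borel_measurable (gen_sigma M X {..?s})" if "j \<le> m" for j
        proof (cases "t j > 0")
          case True
          then show ?thesis using mono[of j m] that Suc.prems pos
            by (intro lamperti_measurable_past) auto
        next
          case False
          then have "lamperti 1 X (t j) = (\<lambda>_. 0)" by (simp add: lamperti_def fun_eq_iff)
          then show ?thesis by simp
        qed
        with that show ?thesis unfolding D_def[abs_def] by (intro borel_measurable_diff) auto
      qed
      have A: "?A \<in> sets (gen_sigma M X {..?s})"
      proof -
        have "{x \<in> space (gen_sigma M X {..?s}). \<forall>i\<in>{..<m}. D i x \<in> B i} \<in> sets (gen_sigma M X {..?s})"
        proof (rule sets.sets_Collect_finite_All)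
          fix i assume "i \<in> {..<m}"
          then have "D i -` B i \<inter> space (gen_sigma M X {..?s}) \<in> sets (gen_sigma M X {..?s})"
            using meas B by (intro measurable_sets) auto
          then show "{x \<in> space (gen_sigma M X {..?s}). D i x \<in> B i} \<in> sets (gen_sigma M X {..?s})"
            by (simp add: vimage_def Int_def conj_commute)
        qed (rule finite_lessThan)
        moreover have "{x \<in> space (gen_sigma M X {..?s}). \<forall>i\<in>{..<m}. D i x \<in> B i} = ?A" by auto
        ultimately show ?thesis by (simp only:)
      qed
      \<comment> \<open>The increment is a multiple of the innovation; \<open>C\<close> is the set
        the innovation has to hit.\<close>
      define C where "C = (\<lambda>v. sqrt (t (Suc m)) * v) -` B m"
      have "(\<lambda>v. sqrt (t (Suc m)) * v) \<in> borel_measurable borel" by measurable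
      from measurable_sets[OF this B[of m]] have "C \<in> sets borel" by (simp add: C_def)
      have "D m x = sqrt (t (Suc m)) * innovation ?s ?t x" for x
        unfolding D_def by (rule lamperti_increment[OF pos])
      then have vimage: "D m -` B m = innovation ?s ?t -` C"
        by (auto simp: C_def)
      have "prob (?A \<inter> (D m -` B m \<inter> space M)) = prob ?A * prob (D m -` B m \<inter> space M)"
        unfolding vimage by (rule innovation_indep[OF \<open>?s < ?t\<close> A \<open>C \<in> sets borel\<close>])
      also have "prob ?A = (\<Prod>i<m. prob (D i -` B i \<inter> space M))"
        using Suc.IH Suc.prems by simp
      finally show ?thesis unfolding split by simp
    qed
  qed
  show "indep_vars (\<lambda>_. borel) (\<lambda>i x. lamperti 1 X (t (Suc i)) x - lamperti 1 X (t i) x) {..<n}"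
  \<comment> \<open>The criterion \<open>indep_sets_finite\<close> asks for a nonempty index
    set.\<close>
  proof (cases "n = 0")
    case True
    then show ?thesis by (simp add: indep_vars_def2 indep_sets_def)
  next
    case False
    have "indep_vars (\<lambda>_. borel) D {..<n}"
      unfolding indep_vars_def2
    proof (intro conjI ballI)
      let ?F = "\<lambda>i. {D i -` A \<inter> space M |A. A \<in> sets borel}"
      show "indep_sets ?F {..<n}"
      proof (subst indep_sets_finite)
        show "?F i \<subseteq> events" for i by auto
        show "space M \<in> ?F i" for i by (auto intro!: exI[of _ UNIV])
        show "\<forall>A\<in>Pi {..<n} ?F. prob (\<Inter>j\<in>{..<n}. A j) = (\<Prod>j\<in>{..<n}. prob (A j))"
        proof
          fix A assume "A \<in> Pi {..<n} ?F"
          then have "\<forall>i\<in>{..<n}. \<exists>B. B \<in> sets borel \<and> A i = D i -` B \<inter> space M" by blast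
          then obtain B where B: "\<forall>i\<in>{..<n}. B i \<in> sets borel \<and> A i = D i -` B i \<inter> space M"
            unfolding bchoice_iff by blast
          define B' where "B' i = (if i < n then B i else UNIV)" for i
          have "B' i \<in> sets borel" for i using B by (auto simp: B'_def)
          from prod[of n B', OF order_refl this]
          have "prob {x\<in>space M. \<forall>i<n. D i x \<in> B' i} = (\<Prod>i<n. prob (A i))"
            using B by (simp add: B'_def)
          also have "{x\<in>space M. \<forall>i<n. D i x \<in> B' i} = (\<Inter>j\<in>{..<n}. A j)"
            using B False by (auto simp: B'_def)
          finally show "prob (\<Inter>j\<in>{..<n}. A j) = (\<Prod>j\<in>{..<n}. prob (A j))" .
        qed
      qed (use False in auto)
    qed measurable
    then show ?thesis by (simp add: D_def[abs_def])
  qed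
qed

text \<open>Evaluating the series at \<open>y * sqrt u\<close> multiplies the j-th coefficient by
  u^(j/2), which also explains the radius. For the increment, the factorisation of the generating
  function makes the exponent a difference.\<close>

lemma
  assumes mgf: "has_mgf_exp_series M (X 0) \<delta> R" and \<tau>: "\<tau> > 0"
  shows has_mgf_lamperti: "has_mgf_exp_series M (lamperti 1 X \<tau>) (\<lambda>j. \<delta> j * \<tau> powr (real j / 2)) (R / sqrt \<tau>)"
    and has_mgf_lamperti_increment: "0 < \<sigma> \<Longrightarrow> \<sigma> < \<tau> \<Longrightarrow>
      has_mgf_exp_series M (\<lambda>x. lamperti 1 X \<tau> x - lamperti 1 X \<sigma> x)
        (\<lambda>j. \<delta> j * (\<tau> powr (real j / 2) - \<sigma> powr (real j / 2))) (R / sqrt \<tau>)"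
proof -
  have powr: "u powr (real j / 2) = sqrt u ^ j" if "u > 0" for u j
    using that by (simp add: powr_half_sqrt[symmetric] powr_powr powr_realpow[symmetric] mult.commute)
  define \<psi> where "\<psi> y = (\<Sum>j. \<delta> (j + 2) * y ^ (j + 2) / fact (j + 2))" for y
  have summable: "summable (\<lambda>j. \<delta> (j + 2) * y ^ (j + 2) / fact (j + 2))" if "\<bar>y\<bar> < R" for y
    using mgf that by (auto simp: has_mgf_exp_series_def)
  have mgf_X: "(\<integral>x. exp (y * X t x) \<partial>M) = exp (\<psi> y)" if "\<bar>y\<bar> < R" for y t
    using mgf that integral_law[of "\<lambda>v. exp (y * v)" t] by (simp add: has_mgf_exp_series_def \<psi>_def)
  have scaled: "\<delta> (j + 2) * u powr (real (j + 2) / 2) * y ^ (j + 2) / fact (j + 2)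
      = \<delta> (j + 2) * (y * sqrt u) ^ (j + 2) / fact (j + 2)" if "u > 0" for u y j
    using that by (simp only: powr power_mult_distrib mult_ac)
  have y_lt: "\<bar>y * sqrt u\<bar> < R" if "\<bar>y\<bar> < R / sqrt \<tau>" "0 < u" "u \<le> \<tau>" for u y
  proof -
    have "\<bar>y * sqrt u\<bar> \<le> \<bar>y\<bar> * sqrt \<tau>" using that by (simp add: abs_mult mult_left_mono)
    also have "\<dots> < R" using that \<tau> by (simp add: pos_less_divide_eq)
    finally show ?thesis .
  qed
  show "has_mgf_exp_series M (lamperti 1 X \<tau>) (\<lambda>j. \<delta> j * \<tau> powr (real j / 2)) (R / sqrt \<tau>)"
    unfolding has_mgf_exp_series_def scaled[OF \<tau>]
  proof (intro allI impI conjI)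
    fix y assume y: "\<bar>y\<bar> < R / sqrt \<tau>"
    note lt = y_lt[OF y \<tau> order_refl]
    have eq: "y * lamperti 1 X \<tau> x = y * sqrt \<tau> * X (ln \<tau> / 2) x" for x
      using \<tau> by (simp add: lamperti_pos)
    show "integrable M (\<lambda>x. exp (y * lamperti 1 X \<tau> x))"
      unfolding eq by (rule exp_integrable[OF lt])
    show "summable (\<lambda>j. \<delta> (j + 2) * (y * sqrt \<tau>) ^ (j + 2) / fact (j + 2))"
      by (rule summable[OF lt])
    show "(\<integral>x. exp (y * lamperti 1 X \<tau> x) \<partial>M) =
        exp (\<Sum>j. \<delta> (j + 2) * (y * sqrt \<tau>) ^ (j + 2) / fact (j + 2))"
      unfolding eq mgf_X[OF lt] \<psi>_def ..
  qed
  show "has_mgf_exp_series M (\<lambda>x. lamperti 1 X \<tau> x - lamperti 1 X \<sigma> x)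
        (\<lambda>j. \<delta> j * (\<tau> powr (real j / 2) - \<sigma> powr (real j / 2))) (R / sqrt \<tau>)"
    if \<sigma>: "0 < \<sigma>" "\<sigma> < \<tau>"
    unfolding has_mgf_exp_series_def
  proof (intro allI impI conjI)
    fix y assume y: "\<bar>y\<bar> < R / sqrt \<tau>"
    note lt_\<tau> = y_lt[OF y \<tau> order_refl] and lt_\<sigma> = y_lt[OF y \<sigma>(1) less_imp_le[OF \<sigma>(2)]]
    let ?s = "ln \<sigma> / 2" and ?t = "ln \<tau> / 2"
    have "?s < ?t" using \<sigma> by simp
    have eq: "y * (lamperti 1 X \<tau> x - lamperti 1 X \<sigma> x) = y * sqrt \<tau> * innovation ?s ?t x" for x
      unfolding lamperti_increment[OF \<sigma>(1) \<tau>] by simp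
    have \<rho>: "y * sqrt \<tau> * exp (?s - ?t) = y * sqrt \<sigma>"
      using \<sigma> \<tau> by (simp add: exp_half_ln_diff)
    show "integrable M (\<lambda>x. exp (y * (lamperti 1 X \<tau> x - lamperti 1 X \<sigma> x)))"
      unfolding eq by (rule innovation_exp_integrable[OF \<open>?s < ?t\<close> lt_\<tau>])
    have summand: "\<delta> (j + 2) * (\<tau> powr (real (j + 2) / 2) - \<sigma> powr (real (j + 2) / 2)) * y ^ (j + 2) / fact (j + 2)
        = \<delta> (j + 2) * (y * sqrt \<tau>) ^ (j + 2) / fact (j + 2) - \<delta> (j + 2) * (y * sqrt \<sigma>) ^ (j + 2) / fact (j + 2)" for j
      unfolding scaled[OF \<tau>, symmetric] scaled[OF \<sigma>(1), symmetric]
      by (simp only: right_diff_distrib left_diff_distrib diff_divide_distrib)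
    show "summable (\<lambda>j. \<delta> (j + 2) * (\<tau> powr (real (j + 2) / 2) - \<sigma> powr (real (j + 2) / 2)) * y ^ (j + 2) / fact (j + 2))"
      unfolding summand by (intro summable_diff summable lt_\<tau> lt_\<sigma>)
    have "exp (\<psi> (y * sqrt \<tau>)) = exp (\<psi> (y * sqrt \<sigma>)) * (\<integral>x. exp (y * sqrt \<tau> * innovation ?s ?t x) \<partial>M)"
      using mgf_innovation[OF \<open>?s < ?t\<close> lt_\<tau>] unfolding \<rho> mgf_X[OF lt_\<tau>] mgf_X[OF lt_\<sigma>] .
    then have "(\<integral>x. exp (y * sqrt \<tau> * innovation ?s ?t x) \<partial>M) = exp (\<psi> (y * sqrt \<tau>) - \<psi> (y * sqrt \<sigma>))"
      by (simp add: exp_diff)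
    then show "(\<integral>x. exp (y * (lamperti 1 X \<tau> x - lamperti 1 X \<sigma> x)) \<partial>M) =
        exp (\<Sum>j. \<delta> (j + 2) * (\<tau> powr (real (j + 2) / 2) - \<sigma> powr (real (j + 2) / 2)) * y ^ (j + 2) / fact (j + 2))"
      unfolding eq summand \<psi>_def suminf_diff[OF summable[OF lt_\<tau>] summable[OF lt_\<sigma>], symmetric] .
  qed
qed

end

section \<open>Reversible regression forces Gaussianity\<close>

text \<open>The assumption is the backward regression of \<open>X s\<close> on the later
  \<open>X t\<close>, in weak form against monomials, which is what orthogonality of the
  eigenpolynomials delivers.\<close>

locale reversible_ar_process = ar_process +
  assumes reversible_regression: "s < t \<Longrightarrow>
      (\<integral>x. X s x * X t x ^ n \<partial>M) = exp (s - t) * (\<integral>x. X t x ^ (n + 1) \<partial>M)"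
begin

definition mgf :: "real \<Rightarrow> real" where "mgf y = (\<integral>x. exp (y * X 0 x) \<partial>M)"

text \<open>The derivative of \<open>mgf\<close>, written as an expectation so that it can be
  compared with expectations of \<open>X s x * exp (y * X t x)\<close>.\<close>

definition mgf_deriv :: "real \<Rightarrow> real" where "mgf_deriv y = (\<integral>x. X 0 x * exp (y * X 0 x) \<partial>M)"

text \<open>Squaring the exponential doubles the exponent, so \<open>R / 4\<close> stays below
  \<open>R\<close>.\<close>

lemma X_exp_abs_integrable:
  assumes "\<bar>r\<bar> \<le> R / 4"
  shows "integrable M (\<lambda>x. X s x * exp (r * \<bar>X t x\<bar>))"
proof (rule integrable_mult_of_square)
  have "(exp (r * \<bar>v\<bar>))\<^sup>2 = exp ((2 * r) * \<bar>v\<bar>)" for v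
    by (simp add: power2_eq_square flip: exp_add)
  moreover have "integrable M (\<lambda>x. exp ((2 * r) * \<bar>X t x\<bar>))"
  proof (rule Bochner_Integration.integrable_bound)
    show "integrable M (\<lambda>x. exp ((R / 2) * \<bar>X t x\<bar>))"
      using R_pos by (intro exp_abs_integrable) auto
    have "2 * r * \<bar>v\<bar> \<le> R / 2 * \<bar>v\<bar>" for v using assms by (intro mult_right_mono) auto
    then show "AE x in M. norm (exp (2 * r * \<bar>X t x\<bar>)) \<le> norm (exp (R / 2 * \<bar>X t x\<bar>))" by simp
  qed measurable
  ultimately show "integrable M (\<lambda>x. (exp (r * \<bar>X t x\<bar>))\<^sup>2)" by simp
qed (auto simp: power_integrable)

lemma X_exp_integrable:
  assumes "\<bar>y\<bar> \<le> R / 4"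
  shows "integrable M (\<lambda>x. X s x * exp (y * X t x))"
proof (rule Bochner_Integration.integrable_bound)
  show "integrable M (\<lambda>x. X s x * exp (\<bar>y\<bar> * \<bar>X t x\<bar>))"
    using assms by (intro X_exp_abs_integrable) auto
  have "y * v \<le> \<bar>y\<bar> * \<bar>v\<bar>" for v using abs_ge_self[of "y * v"] by (simp add: abs_mult)
  then show "AE x in M. norm (X s x * exp (y * X t x)) \<le> norm (X s x * exp (\<bar>y\<bar> * \<bar>X t x\<bar>))"
    by (auto simp: abs_mult intro!: mult_left_mono)
qed measurable

lemma mgf_pos:
  assumes "\<bar>y\<bar> < R"
  shows "mgf y > 0"
proof -
  have "(\<integral>x. 0 \<partial>M) < (\<integral>x. exp (y * X 0 x) \<partial>M)"
    by (rule integral_less_AE_space) (auto simp: exp_integrable[OF assms] emeasure_space_1)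
  then show ?thesis by (simp add: mgf_def)
qed

text \<open>Both sides are power series in \<open>y\<close>, and
  \<open>reversible_regression\<close> makes their coefficients agree. The expansion lemma is
  complex, hence the embeddings.\<close>

lemma mgf_deriv_reverse:
  assumes st: "s < t" and y: "\<bar>y\<bar> \<le> R / 4"
  shows "(\<integral>x. X s x * exp (y * X t x) \<partial>M) = exp (s - t) * mgf_deriv y"
proof -
  have series: "(\<lambda>j. complex_of_real ((\<integral>x. X r x * X t x ^ j \<partial>M) / fact j * y ^ j)) sums
      complex_of_real (\<integral>x. X r x * exp (y * X t x) \<partial>M)" for r
  proof -
    have "integrable M (\<lambda>x. norm (X r x * exp (\<bar>y\<bar> * \<bar>X t x\<bar>)))"
      using y by (intro integrable_norm X_exp_abs_integrable) auto
    then have "integrable M (\<lambda>x. norm (complex_of_real (X r x)) * exp (norm (complex_of_real y) * \<bar>X t x\<bar>))"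
      by (simp add: abs_mult)
    from exp_integral_power_series[OF _ _ this]
    have "(\<lambda>j. (\<integral>x. complex_of_real (X r x) * of_real (X t x) ^ j \<partial>M) / fact j * of_real y ^ j) sums
      (\<integral>x. complex_of_real (X r x) * exp (of_real y * of_real (X t x)) \<partial>M)" by simp
    moreover have "(\<integral>x. complex_of_real (X r x) * of_real (X t x) ^ j \<partial>M) = of_real (\<integral>x. X r x * X t x ^ j \<partial>M)" for j
      by (simp flip: integral_complex_of_real)
    moreover have "(\<integral>x. complex_of_real (X r x) * exp (of_real y * of_real (X t x)) \<partial>M)
        = of_real (\<integral>x. X r x * exp (y * X t x) \<partial>M)"
      by (simp add: exp_of_real flip: integral_complex_of_real of_real_mult)
    ultimately show ?thesis by simp
  qed
  have "(\<lambda>j. complex_of_real ((\<integral>x. X s x * X t x ^ j \<partial>M) / fact j * y ^ j)) =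
      (\<lambda>j. complex_of_real (exp (s - t)) * complex_of_real ((\<integral>x. X t x * X t x ^ j \<partial>M) / fact j * y ^ j))"
    using reversible_regression[OF st] by (simp add: fun_eq_iff)
  with series[of s] sums_mult[OF series[of t], of "complex_of_real (exp (s - t))"]
  have "complex_of_real (\<integral>x. X s x * exp (y * X t x) \<partial>M) =
      complex_of_real (exp (s - t)) * complex_of_real (\<integral>x. X t x * exp (y * X t x) \<partial>M)"
    using sums_unique2 by simp
  then have "(\<integral>x. X s x * exp (y * X t x) \<partial>M) = exp (s - t) * (\<integral>x. X t x * exp (y * X t x) \<partial>M)"
    by (simp only: of_real_mult[symmetric] of_real_eq_iff)
  also have "(\<integral>x. X t x * exp (y * X t x) \<partial>M) = mgf_deriv y"
    unfolding mgf_deriv_def by (rule integral_law) measurable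
  finally show ?thesis .
qed

text \<open>The logarithmic derivative \<open>mgf_deriv / mgf\<close> commutes with every contraction, hence is linear.\<close>

lemma mgf_deriv_contraction:
  assumes \<rho>: "0 < \<rho>" "\<rho> < 1" and y: "\<bar>y\<bar> \<le> R / 4"
  shows "mgf_deriv (\<rho> * y) * mgf y = \<rho> * mgf_deriv y * mgf (\<rho> * y)"
proof -
  \<comment> \<open>The time lag at which the autoregression factor is \<rho>.\<close>
  define t where "t = - ln \<rho>"
  have t: "0 < t" and \<rho>_eq: "exp (0 - t) = \<rho>" using \<rho> by (auto simp: t_def)
  have yR: "\<bar>y\<bar> < R" using y R_pos by linarith
  have y': "\<bar>\<rho> * y\<bar> \<le> R / 4"
    using mult_mono[of \<rho> 1 "\<bar>y\<bar>" "R / 4"] \<rho> y by (simp add: abs_mult)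
  let ?E = "\<integral>x. exp (y * innovation 0 t x) \<partial>M"
  have "mgf y = (\<integral>x. exp (y * X t x) \<partial>M)" unfolding mgf_def by (rule integral_law[symmetric]) simp
  also have "\<dots> = mgf (\<rho> * y) * ?E"
    using mgf_innovation[OF t yR] unfolding \<rho>_eq mgf_def by (simp add: mult.commute)
  finally have 1: "mgf y = mgf (\<rho> * y) * ?E" .
  have "indep_var borel (X 0) borel (innovation 0 t)"
    by (intro indep_var_innovation t measurable_past order_refl)
  from indep_var_compose[unfolded comp_def, OF this, of "\<lambda>v. v * exp (\<rho> * y * v)" borel "\<lambda>v. exp (y * v)" borel]
  have ind: "indep_var borel (\<lambda>x. X 0 x * exp (\<rho> * y * X 0 x)) borel (\<lambda>x. exp (y * innovation 0 t x))"
    by simp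
  \<comment> \<open>The expectation of \<open>X 0 x * exp (y * X t x)\<close> is evaluated here by
    independence, and then by \<open>mgf_deriv_reverse\<close>.\<close>
  have "(\<integral>x. (X 0 x * exp (\<rho> * y * X 0 x)) * exp (y * innovation 0 t x) \<partial>M) = mgf_deriv (\<rho> * y) * ?E"
    unfolding mgf_deriv_def
    by (rule indep_var_lebesgue_integral[OF ind]) (intro X_exp_integrable y' innovation_exp_integrable t yR)+
  also have "(\<lambda>x. (X 0 x * exp (\<rho> * y * X 0 x)) * exp (y * innovation 0 t x)) = (\<lambda>x. X 0 x * exp (y * X t x))"
    unfolding \<rho>_eq by (simp add: fun_eq_iff mult.assoc algebra_simps flip: exp_add)
  finally have "\<rho> * mgf_deriv y = mgf_deriv (\<rho> * y) * ?E"
    unfolding mgf_deriv_reverse[OF t y] \<rho>_eq .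
  \<comment> \<open>Cross multiplication eliminates the transform \<open>?E\<close> of the
    innovation without dividing by it.\<close>
  with 1 show ?thesis by (simp only: mult_ac)
qed

text \<open>Contracting the fixed point \<open>r\<close> by \<open>y / r\<close> gives
  \<open>mgf_deriv y = k * y * mgf y\<close> on a real interval. Both sides extend holomorphically
  to a strip, where the equation F' = k z F with F(0) = 1 has the solution exp (k z^2 / 2). Its
  values on the imaginary axis form a Gaussian characteristic function.\<close>

lemma stationary_law_gaussian: "\<exists>k. centred_gaussian k (X 0)"
proof -
  define r where "r = R / 4"
  have r: "0 < r" "\<bar>r\<bar> \<le> R / 4" "r < R" using R_pos by (auto simp: r_def)
  define k where "k = mgf_deriv r / (r * mgf r)"
  have mgf_r: "mgf r > 0" using r by (intro mgf_pos) auto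
  have linear: "mgf_deriv y = k * y * mgf y" if "0 < y" "y < r" for y
  proof -
    have "mgf_deriv (y / r * r) * mgf r = y / r * mgf_deriv r * mgf (y / r * r)"
      using that r by (intro mgf_deriv_contraction) auto
    then show ?thesis using mgf_r r by (simp add: k_def field_simps)
  qed
  define F where "F z = (\<integral>x. 1 * exp (z * complex_of_real (X 0 x)) \<partial>M)" for z
  define F' where "F' z = (\<integral>x. complex_of_real (X 0 x) * exp (z * complex_of_real (X 0 x)) \<partial>M)" for z
  define S where "S = {z. Re z < r} \<inter> {z. Re z > - r}"
  have S: "\<bar>Re z\<bar> < r" if "z \<in> S" for z using that by (auto simp: S_def)
  have "open S" unfolding S_def by (intro open_Int open_halfspace_Re_lt open_halfspace_Re_gt)
  have "convex S" unfolding S_def by (intro convex_Int convex_halfspace_Re_lt convex_halfspace_Re_gt)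
  have "0 \<in> S" using r by (simp add: S_def)
  have F_deriv: "(F has_field_derivative F' z) (at z)" if "z \<in> S" for z
    using exp_integral_has_field_derivative[of "\<lambda>_. 1" M "X 0" r z] exp_abs_integrable[of r 0] r S[OF that]
    unfolding F_def[abs_def] F'_def by simp
  have "integrable M (\<lambda>x. norm (X 0 x * exp (r * \<bar>X 0 x\<bar>)))"
    by (intro integrable_norm X_exp_abs_integrable r)
  then have "integrable M (\<lambda>x. norm (complex_of_real (X 0 x)) * exp (r * \<bar>X 0 x\<bar>))"
    by (simp add: abs_mult)
  from exp_integral_has_field_derivative[OF _ _ this S]
  have "\<exists>f'. (F' has_field_derivative f') (at z)" if "z \<in> S" for z
    unfolding F'_def[abs_def] using that by auto
  then have "F' holomorphic_on S" unfolding holomorphic_on_open[OF \<open>open S\<close>] by blast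
  moreover have "F holomorphic_on S"
    unfolding holomorphic_on_open[OF \<open>open S\<close>] using F_deriv by blast
  ultimately have hol: "(\<lambda>z. F' z - of_real k * z * F z) holomorphic_on S"
    by (intro holomorphic_intros)
  \<comment> \<open>A real interval is not open in the complex plane, but it accumulates at 0, which
    is enough for the identity theorem.\<close>
  define U where "U = complex_of_real ` {0<..<r}"
  have "0 islimpt U"
    unfolding islimpt_approachable
  proof (intro allI impI)
    fix e :: real assume "e > 0"
    with r have "complex_of_real (min e r / 2) \<in> U" unfolding U_def by (intro imageI) auto
    moreover have "complex_of_real (min e r / 2) \<noteq> 0" "dist (complex_of_real (min e r / 2)) 0 < e"
      using r \<open>e > 0\<close> by auto
    ultimately show "\<exists>z\<in>U. z \<noteq> 0 \<and> dist z 0 < e" by blast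
  qed
  moreover have "U \<subseteq> S" by (auto simp: U_def S_def)
  moreover have "F' z - of_real k * z * F z = 0" if "z \<in> U" for z
  proof -
    from that obtain y where y: "z = of_real y" "0 < y" "y < r" by (auto simp: U_def)
    have "F z = of_real (mgf y)" "F' z = of_real (mgf_deriv y)"
      unfolding F_def F'_def mgf_def mgf_deriv_def y(1)
      by (simp_all add: exp_of_real flip: integral_complex_of_real of_real_mult)
    then show ?thesis using linear[OF y(2,3)] y(1) by simp
  qed
  ultimately have F': "F' z = of_real k * z * F z" if "z \<in> S" for z
    using analytic_continuation[OF hol \<open>open S\<close> convex_connected[OF \<open>convex S\<close>] _ \<open>0 \<in> S\<close> _ _ that, of U]
    by simp
  \<comment> \<open>Integrating factor: the equation says that this product has derivative 0 on the
    convex strip.\<close>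
  have deriv_0: "((\<lambda>z. F z * exp (- (of_real k * z\<^sup>2 / 2))) has_field_derivative 0) (at z within S)" if "z \<in> S" for z
    by (rule has_field_derivative_at_within)
      (auto intro!: derivative_eq_intros F_deriv that simp: F'[OF that])
  obtain c where c: "\<And>z. z \<in> S \<Longrightarrow> F z * exp (- (of_real k * z\<^sup>2 / 2)) = c"
    using has_field_derivative_zero_constant[OF \<open>convex S\<close> deriv_0] by auto
  have "c = 1" using c[OF \<open>0 \<in> S\<close>] by (simp add: F_def prob_space)
  have "(\<integral>x. iexp (u * X 0 x) \<partial>M) = of_real (exp (- k * u\<^sup>2 / 2))" for u
  proof -
    have "\<i> * of_real u \<in> S" using r by (simp add: S_def)
    from c[OF this] have "F (\<i> * of_real u) * exp (of_real k * (of_real u)\<^sup>2 / 2) = 1"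
      unfolding \<open>c = 1\<close> by (simp add: power_mult_distrib)
    then have "F (\<i> * of_real u) = exp (- (of_real k * (of_real u)\<^sup>2 / 2))"
      by (simp add: exp_minus field_simps)
    then show ?thesis by (simp add: F_def mult.assoc flip: exp_of_real)
  qed
  then show ?thesis unfolding centred_gaussian_def by auto
qed

definition stationary_variance :: real where "stationary_variance = (\<integral>x. (X 0 x)\<^sup>2 \<partial>M)"

lemma X_gaussian: "centred_gaussian stationary_variance (X t)"
proof -
  obtain k where k: "centred_gaussian k (X 0)" using stationary_law_gaussian by blast
  have "centred_gaussian k (X t)"
    unfolding centred_gaussian_def
  proof (intro conjI allI)
    show "(\<integral>x. iexp (u * X t x) \<partial>M) = of_real (exp (- k * u\<^sup>2 / 2))" for u
      using k integral_law[of "\<lambda>v. iexp (u * v)" t] by (simp add: centred_gaussian_def)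
  qed measurable
  then show ?thesis using centred_gaussian_unique_variance[OF k] by (simp add: stationary_variance_def)
qed

text \<open>Divide the characteristic function of \<open>X t\<close> by that of
  \<open>exp (s - t) * X s\<close>, which never vanishes.\<close>

lemma innovation_gaussian:
  assumes st: "s < t"
  shows "centred_gaussian (stationary_variance * (1 - (exp (s - t))\<^sup>2)) (innovation s t)"
  unfolding centred_gaussian_def
proof (intro conjI allI)
  fix u
  let ?\<rho> = "exp (s - t)"
  have char: "(\<integral>x. iexp (v * X r x) \<partial>M) = of_real (exp (- stationary_variance * v\<^sup>2 / 2))" for v r
    using X_gaussian[of r] by (simp add: centred_gaussian_def)
  have "indep_var borel (X s) borel (innovation s t)"
    by (intro indep_var_innovation st measurable_past order_refl)
  from indep_var_compose[unfolded comp_def, OF this, of "\<lambda>v. (u * ?\<rho>) * v" borel "\<lambda>v. u * v" borel]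
  have ind: "indep_var borel (\<lambda>x. (u * ?\<rho>) * X s x) borel (\<lambda>x. u * innovation s t x)"
    by simp
  have "(\<lambda>x. (u * ?\<rho>) * X s x + u * innovation s t x) = (\<lambda>x. u * X t x)"
    by (simp add: fun_eq_iff algebra_simps)
  then have eq: "of_real (exp (- stationary_variance * u\<^sup>2 / 2)) =
      of_real (exp (- stationary_variance * (u * ?\<rho>)\<^sup>2 / 2)) * (\<integral>x. iexp (u * innovation s t x) \<partial>M)"
    using iexp_indep_var[OF ind] unfolding fun_eq_iff by (simp only: char)
  have "exp (- stationary_variance * u\<^sup>2 / 2) = exp (- stationary_variance * (u * ?\<rho>)\<^sup>2 / 2) * exp (- (stationary_variance * (1 - ?\<rho>\<^sup>2)) * u\<^sup>2 / 2)"
    unfolding exp_add[symmetric] by (simp add: field_simps power_mult_distrib)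
  with eq have "of_real (exp (- stationary_variance * (u * ?\<rho>)\<^sup>2 / 2)) * (\<integral>x. iexp (u * innovation s t x) \<partial>M) =
      of_real (exp (- stationary_variance * (u * ?\<rho>)\<^sup>2 / 2)) * complex_of_real (exp (- (stationary_variance * (1 - ?\<rho>\<^sup>2)) * u\<^sup>2 / 2))"
    by (simp only: of_real_mult)
  then show "(\<integral>x. iexp (u * innovation s t x) \<partial>M) = of_real (exp (- (stationary_variance * (1 - ?\<rho>\<^sup>2)) * u\<^sup>2 / 2))"
    unfolding mult_cancel_left of_real_eq_0_iff using exp_not_eq_zero by blast
qed measurable

text \<open>Replace the latest value \<open>X b\<close> by its innovation over the preceding time
  \<open>a\<close> plus \<open>exp (a - b) * X a\<close>. The innovation is independent of the
  remaining combination, whose coefficient at \<open>a\<close> has changed; hence the induction over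
  arbitrary \<open>c\<close>.\<close>

lemma linear_combination_gaussian:
  assumes "finite J"
  shows "\<exists>k. centred_gaussian k (\<lambda>x. \<Sum>j\<in>J. c j * X j x)"
  using assms
proof (induction J arbitrary: c rule: finite_linorder_max_induct)
  case empty
  have "centred_gaussian 0 (\<lambda>x. 0)" by (auto simp: centred_gaussian_def prob_space)
  then show ?case by auto
next
  case (insert b A)
  have "b \<notin> A" using insert.hyps by blast
  show ?case
  proof (cases "A = {}")
    case True
    then show ?thesis using centred_gaussian_scale[OF X_gaussian, of "c b" b] by auto
  next
    case False
    define a where "a = Max A"
    have a: "a \<in> A" "a < b" "\<And>j. j \<in> A \<Longrightarrow> j \<le> a"
      using False insert.hyps by (auto simp: a_def)
    define c' where "c' = c(a := c a + c b * exp (a - b))"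
    obtain k where k: "centred_gaussian k (\<lambda>x. \<Sum>j\<in>A. c' j * X j x)" using insert.IH by blast
    have "(\<lambda>x. \<Sum>j\<in>A. c' j * X j x) \<in> borel_measurable (gen_sigma M X {..a})"
      using a(3) by (intro borel_measurable_sum borel_measurable_times borel_measurable_const measurable_past)
    from indep_var_innovation[OF a(2) this]
    have ind: "indep_var borel (\<lambda>x. \<Sum>j\<in>A. c' j * X j x) borel (innovation a b)" .
    from indep_var_compose[unfolded comp_def, OF this, of "\<lambda>v. v" borel "\<lambda>v. c b * v" borel]
    have "indep_var borel (\<lambda>x. \<Sum>j\<in>A. c' j * X j x) borel (\<lambda>x. c b * innovation a b x)" by simp
    note centred_gaussian_add[OF k centred_gaussian_scale[OF innovation_gaussian[OF a(2)], of "c b"] this]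
    moreover have "(\<Sum>j\<in>A. c' j * X j x) + c b * innovation a b x = (\<Sum>j\<in>insert b A. c j * X j x)" for x
    proof -
      have "(\<Sum>j\<in>A. c' j * X j x) = (\<Sum>j\<in>A. c j * X j x) + c b * exp (a - b) * X a x"
        using insert.hyps(1) a(1) by (simp add: c'_def sum.remove[of A a] algebra_simps)
      then show ?thesis using insert.hyps(1) \<open>b \<notin> A\<close> by (simp add: algebra_simps)
    qed
    ultimately show ?thesis by auto
  qed
qed

end

section \<open>Harness property\<close>

context reversible_ar_process
begin

text \<open>For distinct times this is the reversed regression against the first power, up to
  symmetry.\<close>

lemma integral_X_mult: "(\<integral>x. X s x * X t x \<partial>M) = stationary_variance * exp (- \<bar>t - s\<bar>)"
proof -
  have sq: "(\<integral>x. X t x ^ 2 \<partial>M) = stationary_variance" for t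
    unfolding stationary_variance_def by (rule integral_law) measurable
  have less: "(\<integral>x. X s x * X t x \<partial>M) = stationary_variance * exp (- \<bar>t - s\<bar>)" if "s < t" for s t
    using reversible_regression[OF that, of 1] sq[of t] that by (simp add: numeral_2_eq_2)
  consider "s < t" | "s = t" | "t < s" by linarith
  then show ?thesis
  proof cases
    case 3
    then show ?thesis using less[OF 3] by (simp add: mult.commute abs_minus_commute)
  qed (use less sq[of t] in \<open>auto simp: power2_eq_square\<close>)
qed

lemma ornstein_uhlenbeck_if_nondegenerate:
  assumes "stationary M X" "0 < stationary_variance"
  shows "ornstein_uhlenbeck M X"
  unfolding ornstein_uhlenbeck_def gaussian_process_def
proof (intro conjI allI impI)
  fix J :: "real set" and c assume "finite J"
  then obtain k where k: "centred_gaussian k (\<lambda>x. \<Sum>j\<in>J. c j * X j x)"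
    using linear_combination_gaussian by blast
  show "\<exists>m. (AE x in M. (\<Sum>j\<in>J. c j * X j x) = m) \<or>
      (\<exists>\<sigma>>0. distributed M lborel (\<lambda>x. \<Sum>j\<in>J. c j * X j x) (\<lambda>x. ennreal (normal_density m \<sigma> x)))"
  \<comment> \<open>The constant 0 serves both alternatives: a combination of variance 0 has no
    density and is almost surely 0.\<close>
  proof (intro exI[of _ 0])
    show "(AE x in M. (\<Sum>j\<in>J. c j * X j x) = 0) \<or>
      (\<exists>\<sigma>>0. distributed M lborel (\<lambda>x. \<Sum>j\<in>J. c j * X j x) (\<lambda>x. ennreal (normal_density 0 \<sigma> x)))"
    proof (cases "k = 0")
      case True
      then show ?thesis using centred_gaussian_AE_zero[OF k] by blast
    next
      case False
      then have "0 < k" using centred_gaussian_nonneg[OF k] by simp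
      then show ?thesis using centred_gaussian_distributed[OF k] real_sqrt_gt_zero by blast
    qed
  qed
next
  have "covariance M (X t) (X s) = (sqrt stationary_variance)\<^sup>2 * exp (- 1 * \<bar>t - s\<bar>)" for s t
    using assms(2) integral_X_mult[of t s] by (simp add: covariance_def mean abs_minus_commute)
  then show "\<exists>\<sigma>>0. \<exists>\<alpha>>0. \<forall>s t. covariance M (X t) (X s) = \<sigma>\<^sup>2 * exp (- \<alpha> * \<bar>t - s\<bar>)"
    using assms(2) by (intro exI[of _ "sqrt stationary_variance"] conjI exI[of _ "1::real"] allI) auto
qed (use assms X_integrable mean in auto)

text \<open>A Gaussian space: all its elements are centred Gaussian and it contains the
  interpolation residuals, so joint characteristic functions reduce to variances.\<close>

definition X_span :: "('a \<Rightarrow> real) set" where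
  "X_span = {Z. \<exists>J c. finite J \<and> Z = (\<lambda>x. \<Sum>j\<in>J. c j * X j x)}"

lemma zero_in_X_span: "(\<lambda>_. 0) \<in> X_span"
  by (auto simp: X_span_def intro!: exI[of _ "{}"])

lemma X_span_add_X:
  assumes "Z \<in> X_span"
  shows "(\<lambda>x. Z x + c * X t x) \<in> X_span"
proof -
  obtain J d where J: "finite J" and Z: "Z = (\<lambda>x. \<Sum>j\<in>J. d j * X j x)"
    using assms by (auto simp: X_span_def)
  \<comment> \<open>\<open>t\<close> may or may not lie in \<open>J\<close>, so \<open>d\<close> is
    extended by 0 before \<open>c\<close> is added at \<open>t\<close>.\<close>
  define d' where "d' = (\<lambda>j. (if j \<in> J then d j else 0) + (if j = t then c else 0))"
  have "Z x + c * X t x = (\<Sum>j\<in>insert t J. d' j * X j x)" for x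
  proof -
    have "(\<Sum>j\<in>insert t J. d' j * X j x) =
        (\<Sum>j\<in>insert t J. if j \<in> J then d j * X j x else 0) + (\<Sum>j\<in>insert t J. if j = t then c * X j x else 0)"
      unfolding sum.distrib[symmetric] by (intro sum.cong) (auto simp: d'_def distrib_right)
    also have "(\<Sum>j\<in>insert t J. if j \<in> J then d j * X j x else 0) = Z x"
      unfolding Z using J by (intro sum.mono_neutral_cong_right) auto
    also have "(\<Sum>j\<in>insert t J. if j = t then c * X j x else 0) = c * X t x"
      using J by (subst sum.delta) auto
    finally show ?thesis ..
  qed
  then show ?thesis unfolding X_span_def using J by blast
qed

lemma X_span_add_scaled:
  assumes "Z \<in> X_span" "W \<in> X_span"
  shows "(\<lambda>x. Z x + c * W x) \<in> X_span"
proof -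
  obtain J d where J: "finite J" and W: "W = (\<lambda>x. \<Sum>j\<in>J. d j * X j x)"
    using assms by (auto simp: X_span_def)
  have "(\<lambda>x. Z x + (\<Sum>j\<in>J. c * d j * X j x)) \<in> X_span"
    using J
  proof (induction J)
    case empty
    then show ?case using assms(1) by simp
  next
    case (insert i J)
    from X_span_add_X[OF insert.IH, of "c * d i" i] show ?case
      using insert.hyps by (simp add: add_ac)
  qed
  then show ?thesis by (simp add: W sum_distrib_left mult.assoc)
qed

lemma lamperti_in_X_span: "lamperti 1 X \<tau> \<in> X_span"
proof (cases "\<tau> > 0")
  case True
  then show ?thesis using X_span_add_X[OF zero_in_X_span, of "sqrt \<tau>" "ln \<tau> / 2"]
    by (simp add: lamperti_pos)
next
  case False
  then have "lamperti 1 X \<tau> = (\<lambda>_. 0)" by (simp add: lamperti_def fun_eq_iff)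
  then show ?thesis using zero_in_X_span by simp
qed

lemma X_span_gaussian:
  assumes "Z \<in> X_span"
  shows "centred_gaussian (\<integral>x. (Z x)\<^sup>2 \<partial>M) Z"
proof -
  obtain k where k: "centred_gaussian k Z"
    using assms linear_combination_gaussian by (auto simp: X_span_def)
  then show ?thesis using centred_gaussian_unique_variance[OF k] by simp
qed

lemma X_span_measurable: "Z \<in> X_span \<Longrightarrow> random_variable borel Z"
  using X_span_gaussian by (auto simp: centred_gaussian_def)

lemma X_span_char: "Z \<in> X_span \<Longrightarrow> (\<integral>x. iexp (Z x) \<partial>M) = of_real (exp (- (\<integral>x. (Z x)\<^sup>2 \<partial>M) / 2))"
  using X_span_gaussian[of Z] by (auto simp: centred_gaussian_def dest!: spec[of _ 1])

lemma X_span_integrable_mult: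
  assumes "Z \<in> X_span" "W \<in> X_span"
  shows "integrable M (\<lambda>x. Z x * W x)"
  using assms
  by (intro integrable_mult_of_square X_span_measurable centred_gaussian_integrable_power[OF X_span_gaussian])

lemma integral_square_add:
  assumes "Z \<in> X_span" "W \<in> X_span" "(\<integral>x. W x * Z x \<partial>M) = 0"
  shows "(\<integral>x. (Z x + c * W x)\<^sup>2 \<partial>M) = (\<integral>x. (Z x)\<^sup>2 \<partial>M) + c\<^sup>2 * (\<integral>x. (W x)\<^sup>2 \<partial>M)"
proof -
  note int = X_span_integrable_mult[OF assms(1,1)] X_span_integrable_mult[OF assms(2,2)]
    X_span_integrable_mult[OF assms(2,1)]
  have "(\<integral>x. (Z x + c * W x)\<^sup>2 \<partial>M) = (\<integral>x. Z x * Z x + (2 * c) * (W x * Z x) + c\<^sup>2 * (W x * W x) \<partial>M)"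
    by (intro Bochner_Integration.integral_cong) (auto simp: power2_eq_square algebra_simps)
  also have "\<dots> = (\<integral>x. Z x * Z x \<partial>M) + 2 * c * (\<integral>x. W x * Z x \<partial>M) + c\<^sup>2 * (\<integral>x. W x * W x \<partial>M)"
    using int
    by (subst Bochner_Integration.integral_add; (intro Bochner_Integration.integrable_add integrable_mult_right)?)
      (auto simp: Bochner_Integration.integral_add)
  finally show ?thesis by (simp add: assms(3) power2_eq_square)
qed

lemma X_span_uncorrelated_indep:
  assumes W: "W \<in> X_span" and Y: "\<And>i. i \<in> I \<Longrightarrow> Y i \<in> X_span"
    and uncorrelated: "\<And>i. i \<in> I \<Longrightarrow> (\<integral>x. W x * Y i x \<partial>M) = 0"
    and A: "A \<in> sets (gen_sigma M Y I)" and B: "B \<in> sets borel"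
  shows "prob (A \<inter> (W -` B \<inter> space M)) = prob A * prob (W -` B \<inter> space M)"
proof (rule prob_inter_of_char[OF _ X_span_measurable[OF W] _ B])
  have [measurable]: "random_variable borel W" by (rule X_span_measurable[OF W])
  have sub: "subalgebra M (gen_sigma M Y I)"
    using Y X_span_measurable by (intro subalgebra_gen_sigma) auto
  then show ev: "A \<in> events" using A by (auto simp: subalgebra_def)
  fix u :: real
  \<comment> \<open>\<open>S\<close> is stable under adding multiples of the \<open>Y i\<close>. For
    \<open>Z\<close> in \<open>S\<close> the variances of \<open>Z\<close> and \<open>u * W\<close>
    add, so the character of their sum factors.\<close>
  define S where "S = {Z \<in> X_span. (\<integral>x. W x * Z x \<partial>M) = 0}"
  define e where "e = (\<integral>x. iexp (u * W x) \<partial>M)"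
  \<comment> \<open>The character of \<open>W\<close> minus its mean: its integral over
    \<open>A\<close> measures the failure of factorisation.\<close>
  define K where "K x = iexp (u * W x) - e" for x
  have int_char: "integrable M (\<lambda>x. iexp (V x))" if "random_variable borel V" for V
    using that by (intro integrable_iexp) auto
  have int_e: "integrable M (\<lambda>x. iexp (u * W x))" by (intro int_char) measurable
  have int_K: "integrable M K" unfolding K_def[abs_def] using int_e by simp
  have "(\<integral>x\<in>A. K x \<partial>M) = 0"
  proof (rule set_integral_gen_sigma_eq_0_of_char[OF int_K, where S = S and Y = Y and I = I, OF _ _ _ _ _ A])
    show "random_variable borel (Y i)" if "i \<in> I" for i using that Y X_span_measurable by blast
    show "(\<lambda>_. 0) \<in> S" by (simp add: S_def zero_in_X_span)
    show "(\<lambda>x. Z x + c * Y i x) \<in> S" if Z: "Z \<in> S" and i: "i \<in> I" for Z i c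
    proof -
      have "(\<integral>x. W x * (Z x + c * Y i x) \<partial>M) = (\<integral>x. W x * Z x + c * (W x * Y i x) \<partial>M)"
        by (simp add: algebra_simps)
      also have "\<dots> = 0"
        using Z X_span_integrable_mult[OF W, of Z] X_span_integrable_mult[OF W Y[OF i]] uncorrelated[OF i]
        by (subst Bochner_Integration.integral_add) (auto simp: S_def)
      finally show ?thesis using Z X_span_add_scaled[OF _ Y[OF i]] by (simp add: S_def)
    qed
    show "random_variable borel Z" if "Z \<in> S" for Z using that X_span_measurable by (auto simp: S_def)
    show "(\<integral>x. K x * iexp (Z x) \<partial>M) = 0" if "Z \<in> S" for Z
    proof -
      have Z: "Z \<in> X_span" "(\<integral>x. W x * Z x \<partial>M) = 0" using that by (auto simp: S_def)
      have [measurable]: "random_variable borel Z" by (rule X_span_measurable[OF Z(1)])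
      have "e = of_real (exp (- (u\<^sup>2 * (\<integral>x. (W x)\<^sup>2 \<partial>M)) / 2))"
        using X_span_char[OF X_span_add_scaled[OF zero_in_X_span W, of u]]
        by (simp add: e_def power_mult_distrib)
      moreover have "(\<integral>x. iexp (Z x + u * W x) \<partial>M) =
          of_real (exp (- ((\<integral>x. (Z x)\<^sup>2 \<partial>M) + u\<^sup>2 * (\<integral>x. (W x)\<^sup>2 \<partial>M)) / 2))"
        using X_span_char[OF X_span_add_scaled[OF Z(1) W, of u]]
        unfolding integral_square_add[OF Z(1) W Z(2)] .
      moreover have "exp (- ((\<integral>x. (Z x)\<^sup>2 \<partial>M) + u\<^sup>2 * (\<integral>x. (W x)\<^sup>2 \<partial>M)) / 2) =
          exp (- (u\<^sup>2 * (\<integral>x. (W x)\<^sup>2 \<partial>M)) / 2) * exp (- (\<integral>x. (Z x)\<^sup>2 \<partial>M) / 2)"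
        unfolding exp_add[symmetric] by (simp add: field_simps)
      ultimately have prod: "(\<integral>x. iexp (Z x + u * W x) \<partial>M) = e * (\<integral>x. iexp (Z x) \<partial>M)"
        unfolding X_span_char[OF Z(1)] by (simp only: of_real_mult)
      have "(\<integral>x. K x * iexp (Z x) \<partial>M) = (\<integral>x. iexp (Z x + u * W x) - e * iexp (Z x) \<partial>M)"
        by (intro Bochner_Integration.integral_cong) (auto simp: K_def exp_add algebra_simps)
      also have "\<dots> = (\<integral>x. iexp (Z x + u * W x) \<partial>M) - (\<integral>x. e * iexp (Z x) \<partial>M)"
        by (intro Bochner_Integration.integral_diff integrable_mult_right int_char) measurable
      finally show ?thesis unfolding prod by simp
    qed
  qed
  moreover have "(\<integral>x\<in>A. K x \<partial>M) = (\<integral>x. indicator A x * iexp (u * W x) - e * indicator A x \<partial>M)"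
    unfolding set_lebesgue_integral_def
    by (intro Bochner_Integration.integral_cong) (auto simp: K_def indicator_def)
  ultimately have "(\<integral>x. indicator A x * iexp (u * W x) - e * indicator A x \<partial>M) = 0" by simp
  moreover have int_A: "integrable M (\<lambda>x. indicator A x * iexp (u * W x))"
  proof -
    have "(\<lambda>x. indicator A x * iexp (u * W x)) = (\<lambda>x. indicator A x *\<^sub>R iexp (u * W x))"
      by (auto simp: indicator_def)
    then show ?thesis using integrable_mult_indicator[OF ev int_e] by (simp only:)
  qed
  moreover have "(\<lambda>x. indicator A x :: complex) = (\<lambda>x. complex_of_real (indicator A x))"
    by (auto simp: indicator_def)
  then have "integrable M (\<lambda>x. indicator A x :: complex)" "(\<integral>x. indicator A x \<partial>M) = complex_of_real (prob A)"
    using ev by (auto simp: less_top[symmetric])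
  ultimately have 1: "(\<integral>x. indicator A x * iexp (u * W x) \<partial>M) = e * complex_of_real (prob A)"
    by (subst (asm) Bochner_Integration.integral_diff) auto
  have "(\<integral>x. (indicator A x - prob A) * iexp (u * W x) \<partial>M) =
      (\<integral>x. indicator A x * iexp (u * W x) - prob A * iexp (u * W x) \<partial>M)"
    by (intro Bochner_Integration.integral_cong) (auto simp: indicator_def algebra_simps)
  also have "\<dots> = (\<integral>x. indicator A x * iexp (u * W x) \<partial>M) - (\<integral>x. prob A * iexp (u * W x) \<partial>M)"
    by (intro Bochner_Integration.integral_diff int_A integrable_mult_right int_e)
  finally show "(\<integral>x. (indicator A x - prob A) * iexp (u * W x) \<partial>M) = 0"
    unfolding 1 by (simp add: e_def)
qed

text \<open>The Brownian covariance: for \<sigma> \<le> \<tau> the correlation is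
  \<open>sqrt \<sigma> / sqrt \<tau>\<close>, and the scaling factors turn it into \<sigma>.\<close>

lemma integral_lamperti_mult:
  assumes "0 < \<sigma>" "0 < \<tau>"
  shows "(\<integral>x. lamperti 1 X \<sigma> x * lamperti 1 X \<tau> x \<partial>M) = stationary_variance * min \<sigma> \<tau>"
proof -
  have le: "(\<integral>x. lamperti 1 X \<sigma> x * lamperti 1 X \<tau> x \<partial>M) = stationary_variance * \<sigma>"
    if "0 < \<sigma>" "0 < \<tau>" "\<sigma> \<le> \<tau>" for \<sigma> \<tau>
  proof -
    have "(\<integral>x. lamperti 1 X \<sigma> x * lamperti 1 X \<tau> x \<partial>M) =
        (\<integral>x. (sqrt \<sigma> * sqrt \<tau>) * (X (ln \<sigma> / 2) x * X (ln \<tau> / 2) x) \<partial>M)"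
      using that by (simp add: lamperti_pos mult_ac)
    also have "\<dots> = sqrt \<sigma> * sqrt \<tau> * (stationary_variance * exp (- \<bar>ln \<tau> / 2 - ln \<sigma> / 2\<bar>))"
      by (simp only: integral_mult_right_zero integral_X_mult)
    also have "- \<bar>ln \<tau> / 2 - ln \<sigma> / 2\<bar> = ln \<sigma> / 2 - ln \<tau> / 2" using that by simp
    also have "sqrt \<sigma> * sqrt \<tau> * (stationary_variance * exp (ln \<sigma> / 2 - ln \<tau> / 2)) = stationary_variance * \<sigma>"
      unfolding exp_half_ln_diff[OF that(1,2)] using that by simp
    finally show ?thesis .
  qed
  show ?thesis
  proof (cases "\<sigma> \<le> \<tau>")
    case True
    then show ?thesis using le[OF assms True] by (simp add: min_absorb1)
  next
    case False
    then show ?thesis using le[of \<tau> \<sigma>] assms by (simp add: min_absorb2 mult.commute)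
  qed
qed

lemma harness_lamperti: "harness_on M {0<..} (lamperti 1 X)"
  unfolding harness_on_def
proof (intro conjI ballI impI)
  let ?Y = "lamperti 1 X"
  have int_Y: "integrable M (?Y \<tau>)" for \<tau>
    using centred_gaussian_integrable_power[OF X_span_gaussian[OF lamperti_in_X_span], where n = 1] by simp
  show "integrable M (?Y t)" for t by (rule int_Y)
  fix s t u :: real assume "s \<in> {0<..}" "t \<in> {0<..}" "u \<in> {0<..}" and st: "s < t" and tu: "t < u"
  then have pos: "0 < s" "0 < t" "0 < u" by auto
  \<comment> \<open>Weights of linear interpolation. Below, \<open>a + b = 1\<close> settles the
    times up to \<open>s\<close>, and \<open>a * s + b * u = t\<close> those from \<open>u\<close>
    on.\<close>
  define a where "a = (u - t) / (u - s)"
  define b where "b = (t - s) / (u - s)"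
  have ab: "a + b = 1" "a * s + b * u = t"
    using st tu by (simp_all add: a_def b_def divide_simps) (simp add: algebra_simps)
  define I where "I = {0<..} - {s<..<u}"
  define W where "W x = ?Y t x + - a * ?Y s x + - b * ?Y u x" for x
  have W: "W \<in> X_span"
    unfolding W_def[abs_def] by (intro X_span_add_scaled lamperti_in_X_span)
  have uncorrelated: "(\<integral>x. W x * ?Y i x \<partial>M) = 0" if "i \<in> I" for i
  proof -
    have i: "0 < i" "i \<le> s \<or> u \<le> i" using that by (auto simp: I_def)
    note int = X_span_integrable_mult[OF lamperti_in_X_span lamperti_in_X_span]
    have "(\<integral>x. W x * ?Y i x \<partial>M) =
        (\<integral>x. ?Y t x * ?Y i x + (- a * (?Y s x * ?Y i x) + - b * (?Y u x * ?Y i x)) \<partial>M)"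
      by (intro Bochner_Integration.integral_cong) (auto simp: W_def algebra_simps)
    also have "\<dots> = (\<integral>x. ?Y t x * ?Y i x \<partial>M) +
        (- a * (\<integral>x. ?Y s x * ?Y i x \<partial>M) + - b * (\<integral>x. ?Y u x * ?Y i x \<partial>M))"
      by (subst Bochner_Integration.integral_add,
          intro int, intro Bochner_Integration.integrable_add integrable_mult_right int,
          subst Bochner_Integration.integral_add)
        (intro integrable_mult_right int, intro integrable_mult_right int, simp)
    also have "\<dots> = stationary_variance * (min t i - (a * min s i + b * min u i))"
      unfolding integral_lamperti_mult[OF pos(1) i(1)] integral_lamperti_mult[OF pos(2) i(1)]
        integral_lamperti_mult[OF pos(3) i(1)] by (simp add: algebra_simps)
    also have "min t i - (a * min s i + b * min u i) = 0"
      using i(2)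
    proof
      assume "i \<le> s"
      then have "a * min s i + b * min u i = (a + b) * i"
        using st tu by (simp add: min_absorb2 algebra_simps)
      then show ?thesis using \<open>i \<le> s\<close> st ab by (simp add: min_absorb2)
    next
      assume "u \<le> i"
      then show ?thesis using st tu ab by (simp add: min_absorb1)
    qed
    finally show ?thesis by simp
  qed
  have sub: "subalgebra M (gen_sigma M ?Y I)" by (intro subalgebra_gen_sigma) measurable
  interpret F: finite_measure_subalgebra M "gen_sigma M ?Y I"
    by unfold_locales (rule sub)
  have W_mean: "(\<integral>x. W x \<partial>M) = 0" by (rule centred_gaussian_moment_1[OF X_span_gaussian[OF W]])
  have W_int: "integrable M W"
    using centred_gaussian_integrable_power[OF X_span_gaussian[OF W], where n = 1] by simp
  \<comment> \<open>\<open>W\<close> has mean 0 and is independent of the outside values, so its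
    integral over each of their events is 0, which characterises the conditional
    expectation.\<close>
  have "AE x in M. real_cond_exp M (gen_sigma M ?Y I) (?Y t) x = a * ?Y s x + b * ?Y u x"
  proof (rule F.real_cond_exp_charact)
    have "s \<in> I" "u \<in> I" using pos st tu by (auto simp: I_def)
    then show "(\<lambda>x. a * ?Y s x + b * ?Y u x) \<in> borel_measurable (gen_sigma M ?Y I)"
      by (intro borel_measurable_add borel_measurable_times borel_measurable_const measurable_gen_sigma)
    show int_g: "integrable M (\<lambda>x. a * ?Y s x + b * ?Y u x)"
      by (intro Bochner_Integration.integrable_add integrable_mult_right int_Y)
    show "integrable M (?Y t)" by (rule int_Y)
    fix A assume A: "A \<in> sets (gen_sigma M ?Y I)"
    then have ev: "A \<in> events" using sub by (auto simp: subalgebra_def)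
    have "indep_var borel (indicator A :: _ \<Rightarrow> real) borel W"
    proof (rule indep_varI_prob_inter[OF sub _ X_span_measurable[OF W]])
      show "(indicator A :: _ \<Rightarrow> real) \<in> borel_measurable (gen_sigma M ?Y I)" using A by simp
    qed (rule X_span_uncorrelated_indep[OF W lamperti_in_X_span uncorrelated])
    then have "(\<integral>x. indicator A x * W x \<partial>M) = (\<integral>x. indicator A x \<partial>M) * (\<integral>x. W x \<partial>M)"
      using ev W_int by (intro indep_var_lebesgue_integral) (auto simp: less_top[symmetric])
    then have "(\<integral>x. indicator A x * W x \<partial>M) = 0" by (simp add: W_mean)
    moreover have "(\<integral>x. indicator A x * W x \<partial>M) = (\<integral>x\<in>A. ?Y t x \<partial>M) - (\<integral>x\<in>A. a * ?Y s x + b * ?Y u x \<partial>M)"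
    proof -
      have "(\<integral>x. indicator A x * W x \<partial>M) = (\<integral>x\<in>A. ?Y t x - (a * ?Y s x + b * ?Y u x) \<partial>M)"
        unfolding set_lebesgue_integral_def
        by (intro Bochner_Integration.integral_cong) (auto simp: W_def)
      also have "\<dots> = (\<integral>x\<in>A. ?Y t x \<partial>M) - (\<integral>x\<in>A. a * ?Y s x + b * ?Y u x \<partial>M)"
        using integrable_mult_indicator[OF ev int_Y] integrable_mult_indicator[OF ev int_g]
        by (intro set_integral_diff) (auto simp: set_integrable_def)
      finally show ?thesis .
    qed
    ultimately show "(\<integral>x\<in>A. ?Y t x \<partial>M) = (\<integral>x\<in>A. a * ?Y s x + b * ?Y u x \<partial>M)" by simp
  qed
  moreover have "a \<noteq> 0" using st tu by (simp add: a_def)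
  ultimately show "\<exists>a b c. (a \<noteq> 0 \<or> b \<noteq> 0) \<and>
      (AE x in M. real_cond_exp M (gen_sigma M ?Y ({0<..} - {s<..<u})) (?Y t) x = a * ?Y s x + b * ?Y u x + c)"
    unfolding I_def by (intro exI[of _ a] exI[of _ b] exI[of _ 0]) auto
qed

end

section \<open>Monic orthogonal polynomials and Hermite polynomials\<close>

lemma degree_hermite_poly: "degree (hermite_poly n) = n \<and> lead_coeff (hermite_poly n) = 1"
proof (induction n rule: hermite_poly.induct)
  case (3 n)
  have x: "[:0, 1:] * hermite_poly (Suc n) = pCons 0 (hermite_poly (Suc n))" by simp
  have nz: "hermite_poly (Suc n) \<noteq> 0" using 3 by auto
  have deg: "degree ([:0, 1:] * hermite_poly (Suc n)) = Suc (Suc n)"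
    using 3 nz unfolding x by simp
  have less: "degree (Polynomial.smult (real (Suc n)) (hermite_poly n)) < Suc (Suc n)"
    using 3 by simp
  have "degree (hermite_poly (Suc (Suc n))) = Suc (Suc n)"
    unfolding hermite_poly.simps diff_conv_add_uminus
    by (subst degree_add_eq_left) (use deg less in auto)
  moreover have "coeff (hermite_poly (Suc n)) (Suc n) = 1" using 3 by metis
  with less have "coeff (hermite_poly (Suc (Suc n))) (Suc (Suc n)) = 1"
    unfolding hermite_poly.simps coeff_diff x by (simp add: coeff_eq_0)
  ultimately show ?case by (simp only:)
qed auto

text \<open>Differentiating the recurrence reproduces the recurrence one index lower,
  \<open>n + 2\<close> times, plus one further copy from the product rule.\<close>

lemma pderiv_hermite_poly: "pderiv (hermite_poly (Suc n)) = Polynomial.smult (real (Suc n)) (hermite_poly n)"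
proof (induction n rule: hermite_poly.induct)
  case (3 n)
  have "pderiv (hermite_poly (Suc (Suc (Suc n)))) =
      hermite_poly (Suc (Suc n)) + [:0, 1:] * pderiv (hermite_poly (Suc (Suc n)))
        - Polynomial.smult (real (Suc (Suc n))) (pderiv (hermite_poly (Suc n)))"
    by (simp only: hermite_poly.simps(3)[of "Suc n"] pderiv_diff pderiv_mult pderiv_smult)
      (simp add: pderiv_pCons)
  also have "\<dots> = hermite_poly (Suc (Suc n)) + [:0, 1:] * Polynomial.smult (real (Suc (Suc n))) (hermite_poly (Suc n))
        - Polynomial.smult (real (Suc (Suc n))) (Polynomial.smult (real (Suc n)) (hermite_poly n))"
    by (simp only: 3)
  also have "\<dots> = hermite_poly (Suc (Suc n)) + Polynomial.smult (real (Suc (Suc n))) (hermite_poly (Suc (Suc n)))"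
    by (simp only: hermite_poly.simps(3)[of n] smult_diff_right mult_smult_right)
  also have "\<dots> = Polynomial.smult (real (Suc (Suc (Suc n)))) (hermite_poly (Suc (Suc n)))"
    unfolding of_nat_Suc[of "Suc (Suc n)"] smult_add_left by simp
  finally show ?case .
qed (simp_all add: pderiv_pCons pderiv_diff pderiv_mult)

text \<open>This form shows the raising operator, the adjoint of differentiation for the standard
  normal law.\<close>

lemma hermite_poly_Suc: "hermite_poly (Suc n) = [:0, 1:] * hermite_poly n - pderiv (hermite_poly n)"
  by (cases n) (simp_all add: pderiv_hermite_poly del: mult_pCons_left)

text \<open>Cancels the leading term. The alternative \<open>?r = 0\<close> covers constants, whose
  degree cannot drop.\<close>

lemma monic_basis_reduce:
  fixes q :: "nat \<Rightarrow> real poly" and r :: "real poly"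
  assumes q: "\<And>n. degree (q n) = n" "\<And>n. lead_coeff (q n) = 1"
  shows "r - Polynomial.smult (lead_coeff r) (q (degree r)) = 0 \<or>
    degree (r - Polynomial.smult (lead_coeff r) (q (degree r))) < degree r" (is "?r = 0 \<or> _")
proof (cases "degree r = 0")
  case True
  have "degree ?r \<le> 0" using True q(1)[of 0] degree_smult_le[of "lead_coeff r" "q 0"]
    by (intro degree_diff_le) auto
  moreover have "coeff ?r 0 = 0" using True q(1)[of 0] q(2)[of 0] by simp
  ultimately have "?r = 0" by (metis le_zero_eq leading_coeff_0_iff)
  then show ?thesis ..
next
  case False
  have "degree ?r \<le> degree r"
    using q(1)[of "degree r"] degree_smult_le[of "lead_coeff r" "q (degree r)"]
    by (intro degree_diff_le) auto
  moreover have "coeff ?r (degree r) = 0" using q(1)[of "degree r"] q(2)[of "degree r"] by simp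
  ultimately show ?thesis using False by (metis eq_zero_or_degree_less)
qed

text \<open>Strong induction on the degree by cancelling leading terms. The bound \<open>N\<close>
  records that only basis elements of smaller index occur, as orthogonality arguments
  require.\<close>

lemma monic_basis_induct:
  fixes q :: "nat \<Rightarrow> real poly" and r :: "real poly"
  assumes q: "\<And>n. degree (q n) = n" "\<And>n. lead_coeff (q n) = 1"
    and r: "r = 0 \<or> degree r < N"
    and zero: "P 0" and step: "\<And>n c r. n < N \<Longrightarrow> P r \<Longrightarrow> P (Polynomial.smult c (q n) + r)"
  shows "P r"
  using r
proof (induction "degree r" arbitrary: r rule: less_induct)
  case less
  define r' where "r' = r - Polynomial.smult (lead_coeff r) (q (degree r))"
  show ?case
  proof (cases "r = 0")
    case False
    with less.prems have deg: "degree r < N" by simp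
    have "r' = 0 \<or> degree r' < degree r" unfolding r'_def by (rule monic_basis_reduce[OF q])
    then have "P r'" using zero less.hyps[of r'] deg by auto
    from step[OF deg this, of "lead_coeff r"] show ?thesis by (simp add: r'_def)
  qed (use zero in simp)
qed

text \<open>The difference \<open>d\<close> of two candidates has some degree m below
  \<open>n\<close>. By induction \<open>p m = q m\<close>, so both orthogonalities kill
  \<open>L (q m * d)\<close>; but only the leading term of \<open>d\<close> contributes to it, with
  the nonzero factor \<open>L (q m * q m)\<close>.\<close>

lemma monic_orthogonal_polys_unique:
  fixes L :: "real poly \<Rightarrow> real"
  assumes L_add: "\<And>a b. L (a + b) = L a + L b" and L_smult: "\<And>c a. L (Polynomial.smult c a) = c * L a"
    and p: "\<And>n. degree (p n) = n" "\<And>n. lead_coeff (p n) = 1" "\<And>m n. m \<noteq> n \<Longrightarrow> L (p m * p n) = 0"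
    and q: "\<And>n. degree (q n) = n" "\<And>n. lead_coeff (q n) = 1" "\<And>m n. m \<noteq> n \<Longrightarrow> L (q m * q n) = 0"
    and q_nonzero: "\<And>n. L (q n * q n) \<noteq> 0"
  shows "p n = q n"
proof (induction n rule: less_induct)
  case (less n)
  have L_0: "L 0 = 0" using L_smult[of 0 0] by simp
  have lower: "L (q m * r) = 0" if "r = 0 \<or> degree r < m" for m r
  proof (rule monic_basis_induct[OF q(1,2) that])
    fix j c r assume "j < m" "L (q m * r) = 0"
    then show "L (q m * (Polynomial.smult c (q j) + r)) = 0"
      using q(3)[of m j] by (simp add: distrib_left L_add L_smult)
  qed (simp add: L_0)
  define d where "d = p n - q n"
  show ?case
  proof (rule ccontr)
    assume "p n \<noteq> q n"
    then have "d \<noteq> 0" by (simp add: d_def)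
    have "degree d \<le> n" unfolding d_def using p(1) q(1) by (intro degree_diff_le) auto
    moreover have "coeff d n = 0" unfolding d_def using p(1,2)[of n] q(1,2)[of n] by simp
    ultimately have m: "degree d < n"
      using \<open>d \<noteq> 0\<close> eq_zero_or_degree_less by blast
    let ?m = "degree d"
    have "q ?m * d = p ?m * p n + Polynomial.smult (- 1) (q ?m * q n)"
      using less.IH[OF m] by (simp add: d_def right_diff_distrib)
    then have "L (q ?m * d) = 0"
      using m p(3)[of ?m n] q(3)[of ?m n] by (simp only: L_add L_smult)
    moreover have "L (q ?m * d) = lead_coeff d * L (q ?m * q ?m)"
    proof -
      define r where "r = d - Polynomial.smult (lead_coeff d) (q ?m)"
      have "L (q ?m * r) = 0"
        unfolding r_def by (intro lower monic_basis_reduce q)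
      moreover have "q ?m * d = Polynomial.smult (lead_coeff d) (q ?m * q ?m) + q ?m * r"
        by (simp add: r_def right_diff_distrib)
      ultimately show ?thesis by (simp only: L_add L_smult)
    qed
    ultimately show False using q_nonzero \<open>d \<noteq> 0\<close> by simp
  qed
qed

section \<open>Gaussian orthogonality of the Hermite polynomials\<close>

context prob_space
begin

lemma integrable_poly:
  fixes Z :: "'a \<Rightarrow> real"
  assumes "\<And>n. integrable M (\<lambda>x. Z x ^ n)"
  shows "integrable M (\<lambda>x. poly q (Z x))"
  unfolding poly_altdef using assms by (intro Bochner_Integration.integrable_sum integrable_mult_right)

lemma integral_poly_add:
  fixes Z :: "'a \<Rightarrow> real"
  assumes "\<And>n. integrable M (\<lambda>x. Z x ^ n)"
  shows "(\<integral>x. poly (q + r) (Z x) \<partial>M) = (\<integral>x. poly q (Z x) \<partial>M) + (\<integral>x. poly r (Z x) \<partial>M)"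
  unfolding poly_add by (intro Bochner_Integration.integral_add integrable_poly assms)

text \<open>Both sides are linear in \<open>q\<close>, and on monomials the identity is the moment
  recursion.\<close>

lemma gaussian_integration_by_parts:
  assumes Z: "centred_gaussian 1 Z"
  shows "(\<integral>x. poly ([:0, 1:] * q) (Z x) \<partial>M) = (\<integral>x. poly (pderiv q) (Z x) \<partial>M)"
proof -
  note int = centred_gaussian_integrable_power[OF Z]
  define L where "L r = (\<integral>x. poly r (Z x) \<partial>M)" for r
  have L_add: "L (a + b) = L a + L b" for a b unfolding L_def by (rule integral_poly_add[OF int])
  have L_sum: "L (\<Sum>i\<in>I. f i) = (\<Sum>i\<in>I. L (f i))" for I :: "nat set" and f
    by (induction I rule: infinite_finite_induct) (simp_all add: L_add, simp_all add: L_def)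
  have pderiv_sum: "pderiv (\<Sum>i\<in>I. f i) = (\<Sum>i\<in>I. pderiv (f i))" for I :: "nat set" and f :: "nat \<Rightarrow> real poly"
    using higher_pderiv_sum[of 1 f I] by simp
  have L_monom: "L (monom c n) = c * (\<integral>x. Z x ^ n \<partial>M)" for c n
    by (simp add: L_def poly_monom)
  have monom: "L ([:0, 1:] * monom c n) = L (pderiv (monom c n))" for c n
  proof -
    have "[:0, 1:] * monom c n = monom c (Suc n)" by (simp add: monom_Suc)
    \<comment> \<open>At \<open>n = 0\<close> the truncated \<open>n - 1\<close> is harmless because
      of the factor 0; the claim is then that the mean is 0.\<close>
    moreover have "(\<integral>x. Z x ^ Suc n \<partial>M) = real n * (\<integral>x. Z x ^ (n - 1) \<partial>M)"
    proof (cases n)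
      case 0
      then show ?thesis using centred_gaussian_moment_1[OF Z] by simp
    next
      case (Suc m)
      then show ?thesis using centred_gaussian_moment_rec[OF Z, of m] by simp
    qed
    ultimately show ?thesis by (simp add: pderiv_monom L_monom del: power_Suc mult_pCons_left)
  qed
  have "L ([:0, 1:] * (\<Sum>i\<le>degree q. monom (coeff q i) i)) = L (pderiv (\<Sum>i\<le>degree q. monom (coeff q i) i))"
    unfolding sum_distrib_left pderiv_sum L_sum monom ..
  then show ?thesis unfolding poly_as_sum_of_monoms L_def .
qed

text \<open>The raising operator is moved over as a derivative: the product rule creates the same
  term \<open>q * pderiv (hermite_poly n)\<close> on both sides, where it cancels.\<close>

lemma integral_hermite_poly_Suc:
  assumes Z: "centred_gaussian 1 Z"
  shows "(\<integral>x. poly (hermite_poly (Suc n) * q) (Z x) \<partial>M) = (\<integral>x. poly (hermite_poly n * pderiv q) (Z x) \<partial>M)"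
proof -
  note int = centred_gaussian_integrable_power[OF Z]
  have "(\<integral>x. poly (hermite_poly (Suc n) * q + q * pderiv (hermite_poly n)) (Z x) \<partial>M) =
      (\<integral>x. poly ([:0, 1:] * (hermite_poly n * q)) (Z x) \<partial>M)"
    unfolding hermite_poly_Suc by (simp add: algebra_simps del: mult_pCons_left)
  also have "\<dots> = (\<integral>x. poly (hermite_poly n * pderiv q + q * pderiv (hermite_poly n)) (Z x) \<partial>M)"
    unfolding gaussian_integration_by_parts[OF Z] pderiv_mult ..
  finally show ?thesis unfolding integral_poly_add[OF int] by simp
qed

text \<open>Each step moves one derivative onto \<open>q\<close>, and fewer than \<open>n\<close> of
  them already reduce it to a constant.\<close>

lemma integral_hermite_poly_lower:
  assumes Z: "centred_gaussian 1 Z" and "degree q < n"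
  shows "(\<integral>x. poly (hermite_poly n * q) (Z x) \<partial>M) = 0"
  using assms(2)
proof (induction n arbitrary: q)
  case (Suc n)
  show ?case
  proof (cases "degree q = 0")
    case True
    then have "pderiv q = 0" by (simp add: pderiv_eq_0_iff)
    then show ?thesis unfolding integral_hermite_poly_Suc[OF Z] by simp
  next
    case False
    then have "degree (pderiv q) < n" using Suc.prems by (simp add: degree_pderiv)
    then show ?thesis unfolding integral_hermite_poly_Suc[OF Z] by (rule Suc.IH)
  qed
qed simp

lemma integral_hermite_poly_orthogonal:
  assumes Z: "centred_gaussian 1 Z" and "m \<noteq> n"
  shows "(\<integral>x. poly (hermite_poly m * hermite_poly n) (Z x) \<partial>M) = 0"
proof (cases "n < m")
  case True
  then show ?thesis using integral_hermite_poly_lower[OF Z, of "hermite_poly n" m] degree_hermite_poly[of n] by simp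
next
  case False
  then show ?thesis using integral_hermite_poly_lower[OF Z, of "hermite_poly m" n] degree_hermite_poly[of m] assms(2)
    by (simp add: mult.commute)
qed

lemma integral_hermite_poly_square:
  assumes Z: "centred_gaussian 1 Z"
  shows "(\<integral>x. poly (hermite_poly n * hermite_poly n) (Z x) \<partial>M) = fact n"
proof (induction n)
  case (Suc n)
  have "(\<integral>x. poly (hermite_poly (Suc n) * hermite_poly (Suc n)) (Z x) \<partial>M) =
      (\<integral>x. real (Suc n) * poly (hermite_poly n * hermite_poly n) (Z x) \<partial>M)"
    unfolding integral_hermite_poly_Suc[OF Z] pderiv_hermite_poly mult_smult_right poly_smult ..
  then show ?case using Suc by (simp only: integral_mult_right_zero fact_Suc)
qed (simp add: prob_space)

text \<open>Rescaling to the standard normal law substitutes x / sqrt k; the factor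
  \<open>sqrt k ^ n\<close> restores leading coefficient 1 and produces \<open>k ^ n\<close> in the
  squared norm.\<close>

lemma monic_orthogonal_polys_gaussian:
  assumes Z: "centred_gaussian k Z" and k: "0 < k"
    and p: "\<And>n. degree (p n) = n" "\<And>n. lead_coeff (p n) = 1"
      "\<And>m n. m \<noteq> n \<Longrightarrow> (\<integral>x. poly (p m) (Z x) * poly (p n) (Z x) \<partial>M) = 0"
  shows "p n = Polynomial.smult (sqrt k ^ n) (pcompose (hermite_poly n) [:0, 1 / sqrt k:])"
    and "(\<integral>x. (poly (p n) (Z x))\<^sup>2 \<partial>M) = k ^ n * fact n"
proof -
  let ?c = "sqrt k"
  have c: "?c > 0" using k by simp
  define q where "q n = Polynomial.smult (?c ^ n) (pcompose (hermite_poly n) [:0, 1 / ?c:])" for n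
  note int = centred_gaussian_integrable_power[OF Z]
  have W: "centred_gaussian 1 (\<lambda>x. (1 / ?c) * Z x)"
    using centred_gaussian_scale[OF Z, of "1 / ?c"] k by (simp add: power_divide)
  have q_prod: "(\<integral>x. poly (q m * q n) (Z x) \<partial>M) =
      ?c ^ (m + n) * (\<integral>x. poly (hermite_poly m * hermite_poly n) ((1 / ?c) * Z x) \<partial>M)" for m n
    unfolding integral_mult_right_zero[symmetric]
    by (simp add: q_def poly_pcompose power_add mult_ac)
  have q_deg: "degree (q n) = n" "lead_coeff (q n) = 1" for n
  proof -
    have "degree [:0, 1 / ?c:] = 1" using c by simp
    then show deg: "degree (q n) = n" using c degree_hermite_poly[of n] by (simp add: q_def degree_pcompose)
    have "lead_coeff (pcompose (hermite_poly n) [:0, 1 / ?c:]) = (1 / ?c) ^ n"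
      using c degree_hermite_poly[of n] by (subst lead_coeff_comp) auto
    then show "lead_coeff (q n) = 1" using c by (simp add: q_def lead_coeff_smult power_divide)
  qed
  have q_square: "(\<integral>x. poly (q n * q n) (Z x) \<partial>M) = k ^ n * fact n" for n
    unfolding q_prod integral_hermite_poly_square[OF W] using k
    by (simp add: power_add flip: power_mult_distrib)
  have eq: "p n = q n" for n
  proof (rule monic_orthogonal_polys_unique[where L = "\<lambda>r. \<integral>x. poly r (Z x) \<partial>M"])
    show "(\<integral>x. poly (a + b) (Z x) \<partial>M) = (\<integral>x. poly a (Z x) \<partial>M) + (\<integral>x. poly b (Z x) \<partial>M)" for a b
      by (rule integral_poly_add[OF int])
    show "(\<integral>x. poly (q m * q n) (Z x) \<partial>M) = 0" if "m \<noteq> n" for m n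
      unfolding q_prod integral_hermite_poly_orthogonal[OF W that] by simp
    show "(\<integral>x. poly (q n * q n) (Z x) \<partial>M) \<noteq> 0" for n unfolding q_square using k by simp
  qed (use p q_deg in auto)
  then show "p n = Polynomial.smult (?c ^ n) (pcompose (hermite_poly n) [:0, 1 / ?c:])"
    by (simp add: q_def)
  show "(\<integral>x. (poly (p n) (Z x))\<^sup>2 \<partial>M) = k ^ n * fact n"
    using q_square[of n] by (simp add: eq power2_eq_square)
qed

end

section \<open>From polynomial regression to autoregression\<close>

text \<open>A conditional moment that is a constant \<open>c\<close> integrates to
  \<open>c * prob E\<close> over every past event \<open>E\<close>; taking the whole space
  identifies \<open>c\<close> with the unconditional moment.\<close>

lemma (in exp_moment_process) independent_regression_imp_ar_process:
  assumes indep: "independent_regression M X"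
    and regression: "\<And>s t. s < t \<Longrightarrow>
      AE x in M. real_cond_exp M (gen_sigma M X {..s}) (X t) x = exp (s - t) * X s x"
  shows "ar_process M X R"
proof unfold_locales
  fix s t A and B :: "real set"
  assume st: "s < t" and A: "A \<in> sets (gen_sigma M X {..s})" and B: "B \<in> sets borel"
  let ?F = "gen_sigma M X {..s}"
  have ev: "A \<in> events" using A subalgebra_past by (auto simp: subalgebra_def)
  interpret F: finite_measure_subalgebra M ?F by unfold_locales (rule subalgebra_past)
  show "prob (A \<inter> (innovation s t -` B \<inter> space M)) = prob A * prob (innovation s t -` B \<inter> space M)"
  proof (rule prob_inter_of_moments[OF ev _ _ innovation_exp_abs_integrable[OF st] _ B])
    fix j :: nat
    show "(\<integral>x. indicator A x * innovation s t x ^ j \<partial>M) = prob A * (\<integral>x. innovation s t x ^ j \<partial>M)"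
    \<comment> \<open>\<open>independent_regression\<close> speaks of positive exponents
      only.\<close>
    proof (cases "j = 0")
      case True
      then show ?thesis using ev by (simp add: prob_space)
    next
      case False
      define V where "V x = (X t x - real_cond_exp M ?F (X t) x) ^ j" for x
      obtain c where c: "AE x in M. real_cond_exp M ?F V x = c"
        using indep st False unfolding independent_regression_def V_def[abs_def]
        by (metis One_nat_def Suc_leI neq0_conv)
      have [measurable]: "random_variable borel (real_cond_exp M ?F (X t))"
        by (rule borel_measurable_cond_exp2)
      have [measurable]: "random_variable borel V" unfolding V_def[abs_def] by measurable
      have V: "AE x in M. V x = innovation s t x ^ j"
        using regression[OF st] by eventually_elim (simp add: V_def)
      have "integrable M (\<lambda>x. innovation s t x ^ j)"
        using R_pos by (intro integrable_power_of_exp_abs[OF _ _ innovation_exp_abs_integrable[OF st]]) auto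
      then have int: "integrable M V"
        using V by (subst integrable_cong_AE[of _ _ "\<lambda>x. innovation s t x ^ j"]) auto
      have moment: "(\<integral>x. indicator E x * innovation s t x ^ j \<partial>M) = c * prob E" if E: "E \<in> sets ?F" for E
      proof -
        have [measurable]: "E \<in> events" using E subalgebra_past by (auto simp: subalgebra_def)
        have "(\<integral>x. indicator E x * innovation s t x ^ j \<partial>M) = (\<integral>x\<in>E. V x \<partial>M)"
          unfolding set_lebesgue_integral_def
          by (rule integral_cong_AE) (use V in auto)
        also have "\<dots> = (\<integral>x\<in>E. real_cond_exp M ?F V x \<partial>M)" by (rule F.real_cond_exp_intA[OF int E])
        also have "\<dots> = (\<integral>x. c * indicator E x \<partial>M)"
          unfolding set_lebesgue_integral_def
          by (rule integral_cong_AE) (use c borel_measurable_cond_exp2 in auto)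
        finally show ?thesis by simp
      qed
      have "(\<integral>x. innovation s t x ^ j \<partial>M) = (\<integral>x. indicator (space M) x * innovation s t x ^ j \<partial>M)"
        by (intro Bochner_Integration.integral_cong) auto
      also have "\<dots> = c" using moment[of "space M"] sets.top[of ?F] by (simp add: prob_space)
      finally show ?thesis using moment[OF A] by (simp add: mult.commute)
    qed
  qed (use R_pos in auto)
qed

text \<open>By linearity it suffices to test against the eigenpolynomials, where conditioning on the
  past turns the left side into a multiple of E (X_0 p_n(X_0)).\<close>

lemma (in exp_moment_process) orthogonal_eigenpolys_reverse:
  assumes p: "\<And>n. degree (p n) = n" "\<And>n. lead_coeff (p n) = 1" "p 1 = [:0, 1:]"
    and \<alpha>: "\<alpha> 1 = 1"
    and eigen: "\<And>n s t. s < t \<Longrightarrow> AE x in M. real_cond_exp M (gen_sigma M X {..s}) (\<lambda>x. poly (p n) (X t x)) x =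
      exp (- \<alpha> n * (t - s)) * poly (p n) (X s x)"
    and orthogonal: "\<And>m n. m \<noteq> n \<Longrightarrow> (\<integral>x. poly (p m) (X 0 x) * poly (p n) (X 0 x) \<partial>M) = 0"
    and st: "s < t"
  shows "(\<integral>x. X s x * poly q (X t x) \<partial>M) = exp (s - t) * (\<integral>x. X t x * poly q (X t x) \<partial>M)"
proof -
  let ?F = "gen_sigma M X {..s}"
  interpret F: finite_measure_subalgebra M ?F by unfold_locales (rule subalgebra_past)
  have int: "integrable M (\<lambda>x. X r x * poly u (X t x))" for r t u
  proof (rule integrable_mult_of_square)
    have "integrable M (\<lambda>x. poly (u * u) (X t x))" by (rule integrable_poly[OF power_integrable])
    then show "integrable M (\<lambda>x. (poly u (X t x))\<^sup>2)" by (simp add: power2_eq_square)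
    have "(\<lambda>x. poly u (X t x)) = (\<lambda>x. \<Sum>i\<le>degree u. coeff u i * X t x ^ i)"
      by (simp add: poly_altdef)
    then show "random_variable borel (\<lambda>x. poly u (X t x))" by simp
  qed (use power_integrable in auto)
  have poly_borel: "(\<lambda>y. poly u y) \<in> borel_measurable borel" for u :: "real poly"
    by (intro borel_measurable_continuous_onI continuous_intros)
  have basis: "(\<integral>x. X s x * poly (p n) (X t x) \<partial>M) = exp (s - t) * (\<integral>x. X t x * poly (p n) (X t x) \<partial>M)" for n
  proof -
    have [measurable]: "random_variable borel (\<lambda>x. poly (p n) (X r x))" for r
      using measurable_compose[OF rv poly_borel] .
    have "(\<integral>x. X s x * poly (p n) (X t x) \<partial>M) =
        (\<integral>x. X s x * real_cond_exp M ?F (\<lambda>x. poly (p n) (X t x)) x \<partial>M)"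
      by (rule F.real_cond_exp_intg(2)[symmetric]) (auto simp: int measurable_past)
    also have "\<dots> = (\<integral>x. exp (- \<alpha> n * (t - s)) * (X s x * poly (p n) (X s x)) \<partial>M)"
      by (rule integral_cong_AE) (use eigen[OF st, of n] borel_measurable_cond_exp2 in auto)
    also have "\<dots> = exp (- \<alpha> n * (t - s)) * (\<integral>x. X 0 x * poly (p n) (X 0 x) \<partial>M)"
      using integral_law[of "\<lambda>y. y * poly (p n) y" s] poly_borel by simp
    \<comment> \<open>\<open>p 1\<close> is the identity, so the integral vanishes for
      \<open>n \<noteq> 1\<close>, whatever \<open>\<alpha> n\<close> is, and for
      \<open>n = 1\<close> the two factors agree.\<close>
    also have "\<dots> = exp (s - t) * (\<integral>x. X 0 x * poly (p n) (X 0 x) \<partial>M)"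
      using orthogonal[of 1 n] p(3) \<alpha> by (cases "n = 1") auto
    also have "(\<integral>x. X 0 x * poly (p n) (X 0 x) \<partial>M) = (\<integral>x. X t x * poly (p n) (X t x) \<partial>M)"
      using integral_law[of "\<lambda>y. y * poly (p n) y" t] poly_borel by simp
    finally show ?thesis .
  qed
  have "q = 0 \<or> degree q < Suc (degree q)" by simp
  then show ?thesis
  proof (rule monic_basis_induct[OF p(1,2)])
    fix n c r
    assume IH: "(\<integral>x. X s x * poly r (X t x) \<partial>M) = exp (s - t) * (\<integral>x. X t x * poly r (X t x) \<partial>M)"
    have "(\<integral>x. X u x * poly (Polynomial.smult c (p n) + r) (X t x) \<partial>M) =
        c * (\<integral>x. X u x * poly (p n) (X t x) \<partial>M) + (\<integral>x. X u x * poly r (X t x) \<partial>M)" for u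
    proof -
      have "(\<integral>x. X u x * poly (Polynomial.smult c (p n) + r) (X t x) \<partial>M) =
          (\<integral>x. c * (X u x * poly (p n) (X t x)) + X u x * poly r (X t x) \<partial>M)"
        by (simp add: algebra_simps)
      then show ?thesis using int by (simp add: Bochner_Integration.integral_add)
    qed
    then show "(\<integral>x. X s x * poly (Polynomial.smult c (p n) + r) (X t x) \<partial>M) =
        exp (s - t) * (\<integral>x. X t x * poly (Polynomial.smult c (p n) + r) (X t x) \<partial>M)"
      by (simp only: IH basis) (simp add: distrib_left)
  qed simp
qed

lemma measure_support_subset_zero:
  assumes "prob_space M" "X \<in> borel_measurable M" "AE x in M. X x = (0::real)"
  shows "measure_support (distr M borel X) \<subseteq> {0}"
proof
  fix a assume a: "a \<in> measure_support (distr M borel X)"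
  have "emeasure (distr M borel X) (- {0}) = emeasure M (X -` (- {0}) \<inter> space M)"
    using assms(2) by (intro emeasure_distr) auto
  also have "\<dots> = 0"
    using assms(2,3) by (subst AE_iff_measurable[symmetric, where P = "\<lambda>x. X x = 0"]) auto
  finally have "emeasure (distr M borel X) (- {0}) = 0" .
  moreover have "open (- {0::real})" by auto
  ultimately show "a \<in> {0}" using a unfolding measure_support_def by fastforce
qed

lemma nondegenerate_if_num_support_gt_1:
  assumes "prob_space M" "X 0 \<in> borel_measurable M" "1 < num_support M X"
  shows "\<not> (AE x in M. X 0 x = 0)"
proof
  assume "AE x in M. X 0 x = 0"
  from measure_support_subset_zero[OF assms(1,2) this]
  have sub: "measure_support (distr M borel (X 0)) \<subseteq> {0}" .
  then have "card (measure_support (distr M borel (X 0))) \<le> 1"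
    using card_mono[OF _ sub] by simp
  moreover have "finite (measure_support (distr M borel (X 0)))" using sub finite_subset by blast
  ultimately have "num_support M X \<le> enat 1" by (simp add: num_support_def ecard_def)
  then show False using assms(3) by (simp add: one_enat_def)
qed

theorem proposition6:
  fixes M :: "'a measure" and X :: "real \<Rightarrow> 'a \<Rightarrow> real"
    and \<alpha> :: "nat \<Rightarrow> real" and p :: "nat \<Rightarrow> real poly"
    and \<delta> :: "nat \<Rightarrow> real" and R :: real
  assumes "rsmpr M X \<alpha> p"
    and "independent_regression M X"
    and "(\<integral>\<omega>. X 0 \<omega> \<partial>M) = 0"
    and "1 < num_support M X" and "\<alpha> 1 = 1"
    and "R > 0" and "has_mgf_exp_series M (X 0) \<delta> R"
  shows "let Y = lamperti (\<alpha> 1) X in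
     (independent_increments_on M {0..} Y \<and> harness_on M {0<..} Y) \<and>
     ((levy_process M Y \<longrightarrow> ornstein_uhlenbeck M X) \<and>
      (ornstein_uhlenbeck M X \<longleftrightarrow>
         scaled_hermite_upto (num_support M X) (normalized_poly M X p)) \<and>
      (\<forall>\<tau>>0. has_mgf_exp_series M (Y \<tau>) (\<lambda>j. \<delta> j * \<tau> powr (real j / 2)) (R / sqrt \<tau>)) \<and>
      (\<forall>\<sigma> \<tau>. 0 < \<sigma> \<longrightarrow> \<sigma> < \<tau> \<longrightarrow>
         has_mgf_exp_series M (\<lambda>\<omega>. Y \<tau> \<omega> - Y \<sigma> \<omega>)
           (\<lambda>j. \<delta> j * (\<tau> powr (real j / 2) - \<sigma> powr (real j / 2))) (R / sqrt \<tau>)))"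
proof -
  have smpr: "smpr M X" and eigenpolys: "regression_eigenpolys M X \<alpha> p"
    using assms(1) by (auto simp: rsmpr_def)
  have M: "prob_space M" and stationary: "stationary M X" and "markov_process M X"
    using smpr by (auto simp: smpr_def)
  then have rv: "X t \<in> borel_measurable M" for t by (simp add: markov_process_def)
  interpret exp_moment_process M X R
  proof (intro exp_moment_process.intro exp_moment_process_axioms.intro M)
    show "distr M borel (X t) = distr M borel (X 0)" for t
      using stationary by (simp add: stationary_def)
    show "integrable M (\<lambda>x. exp (y * X 0 x))" if "\<bar>y\<bar> < R" for y
      using assms(7) that by (auto simp: has_mgf_exp_series_def)
  qed (use rv assms in auto)
  have v: "enat 0 < num_support M X" "enat 1 < num_support M X"
    using assms(4) le_less_trans[of "enat 0" "enat 1" "num_support M X"] by (auto simp: one_enat_def)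
  have monic: "degree (p n) = n" "lead_coeff (p n) = 1"
    and eigen: "s < t \<Longrightarrow> AE x in M. real_cond_exp M (gen_sigma M X {..s}) (\<lambda>x. poly (p n) (X t x)) x =
      exp (- \<alpha> n * (t - s)) * poly (p n) (X s x)" if "enat n < num_support M X" for n s t
    using eigenpolys that unfolding regression_eigenpolys_def by blast+
  have orthogonal: "(\<integral>x. poly (p m) (X 0 x) * poly (p n) (X 0 x) \<partial>M) = 0"
    if "m \<noteq> n" "enat m < num_support M X" "enat n < num_support M X" for m n
    using assms(1) that unfolding rsmpr_def by blast
  have p0: "p 0 = 1"
    using monic[OF v(1)] by (metis degree_0_id one_pCons)
  \<comment> \<open>Orthogonality of \<open>p 1\<close> to the constant \<open>p 0\<close>, with
    mean 0, will make this constant term vanish.\<close>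
  define b where "b = coeff (p 1) 0"
  have p1_b: "p 1 = [:b, 1:]"
  proof (rule poly_eqI)
    fix i :: nat
    consider "i = 0" | "i = 1" | "1 < i" by linarith
    then show "coeff (p 1) i = coeff [:b, 1:] i"
      using monic[OF v(2)] by cases (auto simp: b_def coeff_eq_0)
  qed
  have "(\<integral>x. b + X 0 x \<partial>M) = 0"
    using orthogonal[of 0 1] v unfolding p0 p1_b by simp
  then have "b = 0"
    using X_integrable[of 0] mean_0 by (simp add: prob_space)
  then have p1: "p 1 = [:0, 1:]" using p1_b by simp
  have "ar_process M X R"
  proof (rule independent_regression_imp_ar_process[OF assms(2)])
    show "AE x in M. real_cond_exp M (gen_sigma M X {..s}) (X t) x = exp (s - t) * X s x"
      if "s < t" for s t
      using eigen[OF v(2) that] unfolding p1 assms(5) by simp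
  qed
  then interpret ar_process M X R .
  have nondegenerate: "\<not> (AE x in M. X 0 x = 0)"
    by (rule nondegenerate_if_num_support_gt_1[OF M rv assms(4)])
  \<comment> \<open>From here on the eigenpolynomials are monic and orthogonal in all degrees, so
    they span all polynomials.\<close>
  have v_inf: "num_support M X = \<infinity>"
    using AE_X_zero_if_finite_support nondegenerate by (auto simp: num_support_def ecard_def)
  interpret reversible_ar_process M X R
  proof
    fix s t n assume st: "(s::real) < t"
    have "(\<integral>x. X s x * poly (monom 1 n) (X t x) \<partial>M) = exp (s - t) * (\<integral>x. X t x * poly (monom 1 n) (X t x) \<partial>M)"
      using monic eigen orthogonal p1 assms(5) st
      by (intro orthogonal_eigenpolys_reverse[of p \<alpha>]) (auto simp: v_inf)
    then show "(\<integral>x. X s x * X t x ^ n \<partial>M) = exp (s - t) * (\<integral>x. X t x ^ (n + 1) \<partial>M)"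
      by (simp add: poly_monom)
  qed
  have "stationary_variance \<noteq> 0"
  proof
    assume "stationary_variance = 0"
    then have "AE x in M. (X 0 x)\<^sup>2 = 0"
      unfolding stationary_variance_def
      by (subst (asm) integral_nonneg_eq_0_iff_AE) (auto simp: power_integrable)
    then show False using nondegenerate by simp
  qed
  then have var: "stationary_variance > 0"
    using centred_gaussian_nonneg[OF X_gaussian[of 0]] by simp
  have ou: "ornstein_uhlenbeck M X" by (rule ornstein_uhlenbeck_if_nondegenerate[OF stationary var])
  have "scaled_hermite_upto (num_support M X) (normalized_poly M X p)"
    unfolding scaled_hermite_upto_def
  \<comment> \<open>Scale of the Gaussian law: the factor
    \<open>sqrt stationary_variance ^ n\<close> of \<open>p n\<close> cancels against its norm and
    leaves \<open>1 / sqrt (fact n)\<close>.\<close>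
  proof (intro exI[of _ "sqrt stationary_variance"] conjI allI impI)
    fix n
    have gauss: "p n = Polynomial.smult (sqrt stationary_variance ^ n)
          (pcompose (hermite_poly n) [:0, 1 / sqrt stationary_variance:])"
      "(\<integral>x. (poly (p n) (X 0 x))\<^sup>2 \<partial>M) = stationary_variance ^ n * fact n"
      using monic orthogonal v_inf
      by (intro monic_orthogonal_polys_gaussian[OF X_gaussian var]; auto)+
    show "normalized_poly M X p n = Polynomial.smult (1 / sqrt (fact n))
        (pcompose (hermite_poly n) [:0, 1 / sqrt stationary_variance:])"
      unfolding normalized_poly_def gauss(2) unfolding gauss(1)
      using var by (simp add: real_sqrt_mult real_sqrt_power)
  qed (use var in simp)
  \<comment> \<open>The Levy implication and the equivalence follow since the Ornstein-Uhlenbeck and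
    the Hermite property are both established.\<close>
  then show ?thesis
    using ou independent_increments_lamperti harness_lamperti has_mgf_lamperti[OF assms(7)]
      has_mgf_lamperti_increment[OF assms(7)]
    unfolding Let_def assms(5) by auto
qed

end
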